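(* Let $(X,T)$ be a topological dynamical system with $T$ a homeomorphism, and let $\mu$ be a $T$-invariant Borel probability measure on $X$. If $\mu$ has bounded complexity with respect to $\{\bar d_n\}$, then $\mu$ has discrete spectrum.
   Context: A t.d.s. $(X,T)$ consists of a compact metric space $(X,d)$ and a continuous map $T\colon X\to X$. Let $\bar d_n(x,y)=\frac1n\sum_{i=0}^{n-1}d(T^ix,T^iy)$, $B_{\bar d_n}(x,\varepsilon)=\{y\colon\bar d_n(x,y)<\varepsilon\}$, and $\overline{\mathrm{span}}_\mu(n,\varepsilon)=\min\{\#(F)\colon F\subset X,\ \mu(\bigcup_{x\in F}B_{\bar d_n}(x,\varepsilon))>1-\varepsilon\}$. $\mu$ has bounded complexity with respect to $\{\bar d_n\}$ if for every $\varepsilon>0$ there is a positive integer $C$ with $\overline{\mathrm{span}}_\mu(n,\varepsilon)\le C$ for all $n\ge1$. An eigenfunction for $\mu$ is a nonzero $f\in L^2(\mu)$ with $f\circ T=\lambda f$ for some $\lambda\in\mathbb{C}$; $\mu$ has discrete spectrum if $L^2(\mu)$ is the closed linear span of its eigenfunctions. *)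

theory Defs
  imports "HOL-Probability.Probability"
begin

definition dbar :: "('a::metric_space \<Rightarrow> 'a) \<Rightarrow> nat \<Rightarrow> 'a \<Rightarrow> 'a \<Rightarrow> real" where
  "dbar T n x y = (1 / real n) * (\<Sum>i<n. dist ((T ^^ i) x) ((T ^^ i) y))"

definition dbar_ball :: "'a set \<Rightarrow> ('a::metric_space \<Rightarrow> 'a) \<Rightarrow> nat \<Rightarrow> 'a \<Rightarrow> real \<Rightarrow> 'a set" where
  "dbar_ball X T n x e = {y \<in> X. dbar T n x y < e}"

definition span_bar :: "'a set \<Rightarrow> ('a::metric_space \<Rightarrow> 'a) \<Rightarrow> 'a measure \<Rightarrow> nat \<Rightarrow> real \<Rightarrow> nat" where
  "span_bar X T M n e = (LEAST k. \<exists>F. F \<subseteq> X \<and> finite F \<and> card F = k \<and>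
       measure M (\<Union>x\<in>F. dbar_ball X T n x e) > 1 - e)"

definition bounded_complexity :: "'a set \<Rightarrow> ('a::metric_space \<Rightarrow> 'a) \<Rightarrow> 'a measure \<Rightarrow> bool" where
  "bounded_complexity X T M \<longleftrightarrow>
     (\<forall>e>0. \<exists>C::nat. C > 0 \<and> (\<forall>n\<ge>1. span_bar X T M n e \<le> C))"

definition square_integrable :: "'a measure \<Rightarrow> ('a \<Rightarrow> complex) \<Rightarrow> bool" where
  "square_integrable M f \<longleftrightarrow> f \<in> borel_measurable M \<and> integrable M (\<lambda>x. (cmod (f x))^2)"

definition eigenfunction :: "'a measure \<Rightarrow> ('a \<Rightarrow> 'a) \<Rightarrow> ('a \<Rightarrow> complex) \<Rightarrow> bool" where
  "eigenfunction M T f \<longleftrightarrow> square_integrable M f \<and> \<not> (AE x in M. f x = 0) \<and>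
     (\<exists>l::complex. AE x in M. f (T x) = l * f x)"

definition discrete_spectrum :: "'a measure \<Rightarrow> ('a \<Rightarrow> 'a) \<Rightarrow> bool" where
  "discrete_spectrum M T \<longleftrightarrow>
     (\<forall>f. square_integrable M f \<longrightarrow>
        (\<forall>e>0. \<exists>G c. finite G \<and> (\<forall>g\<in>G. eigenfunction M T g) \<and>
            (\<integral>x. (cmod (f x - (\<Sum>g\<in>G. c g * g x)))^2 \<partial>M) < e))"

end

theory Submission
  imports Defs "HOL-Computational_Algebra.Fundamental_Theorem_Algebra"
begin

text \<open>
  Idea of the proof. Let \<open>k\<close> be a bounded kernel on \<open>X \<times> X\<close> that is invariant under \<open>T \<times> T\<close>, and \<open>K\<close> its
  integral operator. The eigenspaces of \<open>K\<^sup>* K\<close> for nonzero eigenvalues are finite dimensional and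
  invariant under \<open>f \<mapsto> f \<circ> T\<close>, hence contain eigenfunctions of \<open>T\<close>; splitting these off one after the
  other shows that the range of \<open>K\<close> lies in the closed span of the eigenfunctions. It remains to find
  enough such kernels. The set \<open>B = {(x, y). liminf\<^sub>n dbar T n x y < \<eta>}\<close> is invariant, and bounded
  complexity makes its sections \<open>B\<^sub>x\<close> have measure at least some \<open>\<delta> > 0\<close> for all \<open>x\<close> outside a set of
  measure \<open>\<eta> / 2\<close>. By the maximal ergodic theorem on the product, the average distance from \<open>x\<close> to the
  points of \<open>B\<^sub>x\<close> is at most \<open>\<eta>\<close> in the mean, so the invariant kernel \<open>1\<^sub>B(x, y) / \<mu>(B\<^sub>x)\<close>, cut off where
  \<open>\<mu>(B\<^sub>x) < \<delta>\<close>, almost reproduces every Lipschitz function.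

  All Hilbert space arguments take place among bounded measurable functions: the range of a bounded
  kernel consists of such functions, and \<open>L\<^sup>2\<close>-Cauchy sequences become uniformly Cauchy under it.
\<close>

section \<open>Bounded measurable functions and kernels\<close>

text \<open>On the operator side everything reduces to linear algebra over the complex numbers: the
  operators commute with composition with \<open>T\<close>, so on a finite dimensional eigenspace
  some polynomial in that composition annihilates a given vector, and splitting off its roots
  produces an eigenfunction. On the dynamical side the obstacle is that the covers supplied by
  bounded complexity change with \<open>n\<close>, and no limit object comes with them. Passing to
  pairs that are close for infinitely many \<open>n\<close> loses nothing, since in a probability
  space an upper limit of sets inherits a common lower bound on their measures. It is also enough
  for the maximal ergodic theorem, which asks only for one time at which the Birkhoff sum of
  \<open>\<eta> - dist\<close> is positive; convergence of averages never enters. Dividing by the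
  mass of a section turns a row of the kernel into a probability density, and the cutoff keeps the
  kernel bounded. Both respect invariance, because that mass is constant along orbits.\<close>

definition bdd_meas :: "'a measure \<Rightarrow> ('a \<Rightarrow> complex) \<Rightarrow> bool" where
  "bdd_meas M f \<longleftrightarrow> f \<in> borel_measurable M \<and> (\<exists>C. \<forall>x\<in>space M. cmod (f x) \<le> C)"

definition ip :: "'a measure \<Rightarrow> ('a \<Rightarrow> complex) \<Rightarrow> ('a \<Rightarrow> complex) \<Rightarrow> complex" where
  "ip M f g = (\<integral>x. f x * cnj (g x) \<partial>M)"

definition nsq :: "'a measure \<Rightarrow> ('a \<Rightarrow> complex) \<Rightarrow> real" where
  "nsq M f = (\<integral>x. (cmod (f x))\<^sup>2 \<partial>M)"

definition bdd_kernel :: "'a measure \<Rightarrow> ('a \<Rightarrow> 'a \<Rightarrow> complex) \<Rightarrow> bool" where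
  "bdd_kernel M k \<longleftrightarrow> case_prod k \<in> borel_measurable (M \<Otimes>\<^sub>M M) \<and>
     (\<exists>C. \<forall>x\<in>space M. \<forall>y\<in>space M. cmod (k x y) \<le> C)"

definition kop :: "'a measure \<Rightarrow> ('a \<Rightarrow> 'a \<Rightarrow> complex) \<Rightarrow> ('a \<Rightarrow> complex) \<Rightarrow> 'a \<Rightarrow> complex" where
  "kop M k f x = (\<integral>y. k x y * f y \<partial>M)"

definition adj :: "('a \<Rightarrow> 'a \<Rightarrow> complex) \<Rightarrow> 'a \<Rightarrow> 'a \<Rightarrow> complex" where
  "adj k x y = cnj (k y x)"

definition orthonormal :: "'a measure \<Rightarrow> ('i \<Rightarrow> 'a \<Rightarrow> complex) \<Rightarrow> 'i set \<Rightarrow> bool" where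
  "orthonormal M e I \<longleftrightarrow> (\<forall>i\<in>I. bdd_meas M (e i)) \<and>
     (\<forall>i\<in>I. \<forall>j\<in>I. ip M (e i) (e j) = (if i = j then 1 else 0))"

lemma bdd_meas_measurable [measurable_dest]: "bdd_meas M f \<Longrightarrow> f \<in> borel_measurable M"
  by (simp add: bdd_meas_def)

lemma bdd_meas_const [simp]: "bdd_meas M (\<lambda>x. c)"
  by (auto simp: bdd_meas_def)

lemma bdd_meas_add:
  assumes "bdd_meas M f" "bdd_meas M g"
  shows "bdd_meas M (\<lambda>x. f x + g x)"
proof -
  obtain C D where "\<forall>x\<in>space M. cmod (f x) \<le> C" "\<forall>x\<in>space M. cmod (g x) \<le> D"
    using assms by (auto simp: bdd_meas_def)
  then have "\<forall>x\<in>space M. cmod (f x + g x) \<le> C + D"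
    by (meson add_mono norm_triangle_le)
  then show ?thesis using assms by (auto simp: bdd_meas_def)
qed

lemma bdd_meas_mult:
  assumes "bdd_meas M f" "bdd_meas M g"
  shows "bdd_meas M (\<lambda>x. f x * g x)"
proof -
  obtain C D where "\<forall>x\<in>space M. cmod (f x) \<le> C" "\<forall>x\<in>space M. cmod (g x) \<le> D"
    using assms by (auto simp: bdd_meas_def)
  then have "\<forall>x\<in>space M. cmod (f x * g x) \<le> C * D"
    by (auto simp: norm_mult intro!: mult_mono intro: order_trans[OF norm_ge_zero])
  then show ?thesis using assms by (auto simp: bdd_meas_def)
qed

lemma bdd_meas_cmult: "bdd_meas M f \<Longrightarrow> bdd_meas M (\<lambda>x. c * f x)"
  by (rule bdd_meas_mult) auto

lemma bdd_meas_uminus: "bdd_meas M f \<Longrightarrow> bdd_meas M (\<lambda>x. - f x)"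
  using bdd_meas_cmult[of M f "-1"] by simp

lemma bdd_meas_diff: "bdd_meas M f \<Longrightarrow> bdd_meas M g \<Longrightarrow> bdd_meas M (\<lambda>x. f x - g x)"
  using bdd_meas_add[of M f "\<lambda>x. - g x"] bdd_meas_uminus[of M g] by simp

lemma bdd_meas_cnj: "bdd_meas M f \<Longrightarrow> bdd_meas M (\<lambda>x. cnj (f x))"
  unfolding bdd_meas_def by (auto intro: borel_measurable_continuous_on[where f = cnj] continuous_on_cnj)

lemma bdd_meas_sum: "(\<And>i. i \<in> I \<Longrightarrow> bdd_meas M (f i)) \<Longrightarrow> bdd_meas M (\<lambda>x. \<Sum>i\<in>I. f i x)"
  by (induction I rule: infinite_finite_induct) (auto intro: bdd_meas_add)

lemmas bdd_meas_intros = bdd_meas_add bdd_meas_mult bdd_meas_cmult bdd_meas_uminus bdd_meas_diff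
  bdd_meas_cnj bdd_meas_sum

lemma measurable_cnj [measurable (raw)]:
  "f \<in> borel_measurable M \<Longrightarrow> (\<lambda>x. cnj (f x)) \<in> borel_measurable M"
  by (auto intro: borel_measurable_continuous_on[where f = cnj] continuous_on_cnj)

lemma ip_cnj: "ip M g f = cnj (ip M f g)"
proof -
  have "cnj (ip M f g) = (\<integral>x. cnj (f x * cnj (g x)) \<partial>M)"
    unfolding ip_def by (rule Bochner_Integration.integral_cnj[symmetric])
  then show ?thesis by (simp add: ip_def mult.commute)
qed

lemma ip_self: "ip M f f = of_real (nsq M f)"
  unfolding ip_def nsq_def integral_complex_of_real[symmetric] by (simp only: complex_norm_square)

lemma nsq_nonneg [simp]: "nsq M f \<ge> 0"
  by (simp add: nsq_def)

lemma ip_cong: "(\<And>x. x \<in> space M \<Longrightarrow> f x = f' x) \<Longrightarrow> (\<And>x. x \<in> space M \<Longrightarrow> g x = g' x)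
    \<Longrightarrow> ip M f g = ip M f' g'"
  unfolding ip_def by (intro Bochner_Integration.integral_cong) auto

lemma nsq_cong: "(\<And>x. x \<in> space M \<Longrightarrow> f x = f' x) \<Longrightarrow> nsq M f = nsq M f'"
  unfolding nsq_def by (intro Bochner_Integration.integral_cong) auto

lemma kop_cong: "(\<And>y. y \<in> space M \<Longrightarrow> f y = f' y) \<Longrightarrow> kop M k f x = kop M k f' x"
  unfolding kop_def by (intro Bochner_Integration.integral_cong) auto

lemma nsq_scale: "nsq M (\<lambda>x. c * f x) = (cmod c)\<^sup>2 * nsq M f"
  by (simp add: nsq_def norm_mult power_mult_distrib)

lemma adj_adj [simp]: "adj (adj k) = k"
  by (simp add: adj_def fun_eq_iff)

context prob_space
begin

lemma bdd_meas_integrable: "bdd_meas M f \<Longrightarrow> integrable M f"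
  unfolding bdd_meas_def by (auto intro: integrable_const_bound)

lemma bdd_meas_integrable_nsq: "bdd_meas M f \<Longrightarrow> integrable M (\<lambda>x. (cmod (f x))\<^sup>2)"
proof -
  assume f: "bdd_meas M f"
  then have "integrable M (\<lambda>x. f x * cnj (f x))"
    by (intro bdd_meas_integrable bdd_meas_intros)
  then have "integrable M (\<lambda>x. Re (f x * cnj (f x)))" by (rule integrable_Re)
  then show ?thesis by (simp only: complex_norm_square[symmetric] Re_complex_of_real)
qed

lemma bdd_meas_square_integrable: "bdd_meas M f \<Longrightarrow> square_integrable M f"
  by (simp add: square_integrable_def bdd_meas_integrable_nsq bdd_meas_measurable)

lemma ip_diff_left: "bdd_meas M f \<Longrightarrow> bdd_meas M g \<Longrightarrow> bdd_meas M h \<Longrightarrow>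
    ip M (\<lambda>x. f x - g x) h = ip M f h - ip M g h"
  unfolding ip_def left_diff_distrib
  by (intro Bochner_Integration.integral_diff bdd_meas_integrable bdd_meas_intros)

lemma ip_scale_left: "ip M (\<lambda>x. c * f x) h = c * ip M f h"
  unfolding ip_def by (simp add: mult.assoc)

lemma ip_scale_right: "ip M f (\<lambda>x. c * h x) = cnj c * ip M f h"
  by (subst (1 2) ip_cnj) (simp add: ip_scale_left)

lemma ip_sum_left: "(\<And>i. i \<in> I \<Longrightarrow> bdd_meas M (f i)) \<Longrightarrow> bdd_meas M h \<Longrightarrow>
    ip M (\<lambda>x. \<Sum>i\<in>I. f i x) h = (\<Sum>i\<in>I. ip M (f i) h)"
  unfolding ip_def sum_distrib_right
  by (intro Bochner_Integration.integral_sum bdd_meas_integrable bdd_meas_intros)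

lemma ip_sum_right: "(\<And>i. i \<in> I \<Longrightarrow> bdd_meas M (f i)) \<Longrightarrow> bdd_meas M h \<Longrightarrow>
    ip M h (\<lambda>x. \<Sum>i\<in>I. f i x) = (\<Sum>i\<in>I. ip M h (f i))"
  by (subst (1 2) ip_cnj) (simp add: ip_sum_left)

lemma ip_diff_right: "bdd_meas M f \<Longrightarrow> bdd_meas M g \<Longrightarrow> bdd_meas M h \<Longrightarrow>
    ip M h (\<lambda>x. f x - g x) = ip M h f - ip M h g"
  by (subst (1 2 3) ip_cnj) (simp add: ip_diff_left)

lemma nsq_diff:
  assumes "bdd_meas M f" "bdd_meas M g"
  shows "nsq M (\<lambda>x. f x - g x) = nsq M f + nsq M g - 2 * Re (ip M f g)"
proof -
  have "complex_of_real (nsq M (\<lambda>x. f x - g x)) = ip M f f - ip M g f - (ip M f g - ip M g g)"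
    unfolding ip_self[symmetric] using assms
    by (simp add: ip_diff_left ip_diff_right bdd_meas_diff)
  also have "\<dots> = nsq M f + nsq M g - (ip M f g + cnj (ip M f g))"
    by (simp add: ip_self ip_cnj[of M g f])
  also have "\<dots> = of_real (nsq M f + nsq M g - 2 * Re (ip M f g))"
    by (simp add: complex_add_cnj)
  finally show ?thesis by (simp only: of_real_eq_iff)
qed

lemma nsq_eq_0_AE: "bdd_meas M f \<Longrightarrow> nsq M f = 0 \<Longrightarrow> AE x in M. f x = 0"
  using bdd_meas_integrable_nsq[of f] unfolding nsq_def
  by (subst (asm) integral_nonneg_eq_0_iff_AE) auto

lemma Cauchy_Schwarz_ip:
  assumes f: "bdd_meas M f" and g: "bdd_meas M g"
  shows "(cmod (ip M f g))\<^sup>2 \<le> nsq M f * nsq M g"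
proof (cases "nsq M g = 0")
  case True
  have "AE x in M. f x * cnj (g x) = 0" using nsq_eq_0_AE[OF g True] by auto
  then have "ip M f g = 0" unfolding ip_def by (rule integral_eq_zero_AE)
  then show ?thesis by simp
next
  case False
  then have pos: "nsq M g > 0" using nsq_nonneg[of M g] by linarith
  define c where "c = ip M f g / nsq M g"
  have "0 \<le> nsq M (\<lambda>x. f x - c * g x)" by simp
  also have "\<dots> = nsq M f + (cmod c)\<^sup>2 * nsq M g - 2 * Re (cnj c * ip M f g)"
    using f g by (simp add: nsq_diff bdd_meas_cmult nsq_scale ip_scale_right)
  also have "cnj c * ip M f g = of_real ((cmod (ip M f g))\<^sup>2 / nsq M g)"
    unfolding c_def by (simp add: complex_norm_square mult.commute del: of_real_power)
  also have "(cmod c)\<^sup>2 * nsq M g = (cmod (ip M f g))\<^sup>2 / nsq M g"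
    using pos by (simp add: c_def norm_divide power_divide power2_eq_square)
  finally show ?thesis using pos by (simp add: field_simps)
qed

lemma Bessel:
  assumes "orthonormal M e I" "finite I" and f: "bdd_meas M f"
  shows "(\<Sum>i\<in>I. (cmod (ip M f (e i)))\<^sup>2) \<le> nsq M f"
proof -
  have e: "\<And>i. i \<in> I \<Longrightarrow> bdd_meas M (e i)"
    and o: "\<And>i j. i \<in> I \<Longrightarrow> j \<in> I \<Longrightarrow> ip M (e i) (e j) = (if i = j then 1 else 0)"
    using assms by (auto simp: orthonormal_def)
  define c where "c i = ip M f (e i)" for i
  define p where "p = (\<lambda>x. \<Sum>i\<in>I. c i * e i x)"
  define s where "s = (\<Sum>i\<in>I. (cmod (c i))\<^sup>2)"
  have p: "bdd_meas M p" unfolding p_def by (intro bdd_meas_intros e)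
  have fp: "ip M f p = of_real s"
    unfolding p_def s_def using e f
    by (subst ip_sum_right)
      (auto simp: bdd_meas_cmult ip_scale_right complex_norm_square c_def mult.commute[of "cnj _"]
        simp del: of_real_power)
  have pe: "ip M p (e j) = c j" if "j \<in> I" for j
    unfolding p_def using that e
    by (subst ip_sum_left) (auto simp: bdd_meas_cmult ip_scale_left o assms(2) if_distrib cong: if_cong)
  have "ip M p p = (\<Sum>i\<in>I. cnj (c i) * ip M p (e i))"
    by (subst (2) p_def) (use e p in \<open>simp add: ip_sum_right bdd_meas_cmult ip_scale_right\<close>)
  also have "\<dots> = of_real s"
    unfolding s_def by (simp add: pe complex_norm_square mult.commute[of "cnj _"] del: of_real_power)
  finally have pp: "nsq M p = s" by (simp add: ip_self)
  have "0 \<le> nsq M (\<lambda>x. f x - p x)" by simp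
  also have "\<dots> = nsq M f - s" using f p by (simp add: nsq_diff fp pp)
  finally show ?thesis by (simp add: s_def c_def)
qed

section \<open>Integral operators with bounded kernels\<close>

lemma kernel_adj: "bdd_kernel M k \<Longrightarrow> bdd_kernel M (adj k)"
proof -
  assume k: "bdd_kernel M k"
  then have m [measurable]: "case_prod k \<in> borel_measurable (M \<Otimes>\<^sub>M M)" by (simp add: bdd_kernel_def)
  have "(\<lambda>p. cnj (case_prod k (snd p, fst p))) \<in> borel_measurable (M \<Otimes>\<^sub>M M)" by measurable
  also have "(\<lambda>p. cnj (case_prod k (snd p, fst p))) = case_prod (adj k)"
    by (auto simp: adj_def)
  finally show ?thesis using k unfolding bdd_kernel_def by (auto simp: adj_def)
qed

lemma kernel_row:
  assumes "bdd_kernel M k" "x \<in> space M" shows "bdd_meas M (k x)"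
proof -
  have m [measurable]: "case_prod k \<in> borel_measurable (M \<Otimes>\<^sub>M M)" using assms by (simp add: bdd_kernel_def)
  have "(\<lambda>y. case_prod k (x, y)) \<in> borel_measurable M" using assms(2) by measurable
  then show ?thesis using assms by (auto simp: bdd_kernel_def bdd_meas_def)
qed

text \<open>Brings Bessel and Cauchy-Schwarz to bear at each single point of the range.\<close>

lemma kop_ip: "kop M k f x = ip M f (\<lambda>y. cnj (k x y))"
  by (simp add: kop_def ip_def mult.commute)

lemma bdd_meas_kop:
  assumes k: "bdd_kernel M k" and f: "bdd_meas M f"
  shows "bdd_meas M (kop M k f)"
proof -
  have m [measurable]: "case_prod k \<in> borel_measurable (M \<Otimes>\<^sub>M M)" using k by (simp add: bdd_kernel_def)
  have [measurable]: "f \<in> borel_measurable M" using f by (rule bdd_meas_measurable)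
  obtain C D where C: "\<And>x y. x \<in> space M \<Longrightarrow> y \<in> space M \<Longrightarrow> cmod (k x y) \<le> C"
    and D: "\<And>y. y \<in> space M \<Longrightarrow> cmod (f y) \<le> D"
    using k f unfolding bdd_kernel_def bdd_meas_def by metis
  have "kop M k f \<in> borel_measurable M" unfolding kop_def[abs_def] by measurable
  moreover have "cmod (kop M k f x) \<le> C * D" if x: "x \<in> space M" for x
  proof -
    have "cmod (kop M k f x) \<le> (\<integral>y. cmod (k x y * f y) \<partial>M)" unfolding kop_def
      by (rule integral_norm_bound)
    also have "\<dots> \<le> (\<integral>y. C * D \<partial>M)"
    proof (rule integral_mono)
      show "integrable M (\<lambda>y. cmod (k x y * f y))"
        by (intro integrable_norm bdd_meas_integrable bdd_meas_intros kernel_row k f x)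
      show "cmod (k x y * f y) \<le> C * D" if "y \<in> space M" for y
        using C[OF x that] D[OF that] unfolding norm_mult
        by (intro mult_mono) (auto intro: order_trans[OF norm_ge_zero])
    qed auto
    finally show ?thesis by (simp add: prob_space)
  qed
  ultimately show ?thesis by (auto simp: bdd_meas_def)
qed

lemma kop_scale: "kop M k (\<lambda>y. c * f y) x = c * kop M k f x"
  unfolding kop_ip by (rule ip_scale_left)

lemma kop_adjoint:
  assumes k: "bdd_kernel M k" and f: "bdd_meas M f" and g: "bdd_meas M g"
  shows "ip M (kop M k f) g = ip M f (kop M (adj k) g)"
proof -
  interpret pair_prob_space M M ..
  have m [measurable]: "case_prod k \<in> borel_measurable (M \<Otimes>\<^sub>M M)" using k by (simp add: bdd_kernel_def)
  have [measurable]: "f \<in> borel_measurable M" "g \<in> borel_measurable M"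
    using f g by (auto intro: bdd_meas_measurable)
  obtain C D E where C: "\<And>x y. x \<in> space M \<Longrightarrow> y \<in> space M \<Longrightarrow> cmod (k x y) \<le> C"
    and D: "\<And>y. y \<in> space M \<Longrightarrow> cmod (f y) \<le> D" and E: "\<And>y. y \<in> space M \<Longrightarrow> cmod (g y) \<le> E"
    using k f g unfolding bdd_kernel_def bdd_meas_def by metis
  have int: "integrable (M \<Otimes>\<^sub>M M) (\<lambda>(x, y). k x y * f y * cnj (g x))"
  proof (rule P.integrable_const_bound[where B = "C * D * E"])
    show "AE p in M \<Otimes>\<^sub>M M. cmod (case p of (x, y) \<Rightarrow> k x y * f y * cnj (g x)) \<le> C * D * E"
    proof (rule AE_I2)
      fix p assume "p \<in> space (M \<Otimes>\<^sub>M M)"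
      then obtain x y where p: "p = (x, y)" "x \<in> space M" "y \<in> space M"
        by (auto simp: space_pair_measure)
      have "cmod (k x y) * cmod (f y) * cmod (g x) \<le> C * D * E"
        using C[OF p(2,3)] D[OF p(3)] E[OF p(2)]
        by (intro mult_mono mult_nonneg_nonneg) (auto intro: order_trans[OF norm_ge_zero])
      then show "cmod (case p of (x, y) \<Rightarrow> k x y * f y * cnj (g x)) \<le> C * D * E"
        by (simp add: p norm_mult)
    qed
  qed measurable
  have "ip M (kop M k f) g = (\<integral>x. (\<integral>y. k x y * f y * cnj (g x) \<partial>M) \<partial>M)"
    unfolding ip_def kop_def by simp
  also have "\<dots> = (\<integral>y. (\<integral>x. k x y * f y * cnj (g x) \<partial>M) \<partial>M)"
    using Fubini_integral[OF int] by simp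
  also have "\<dots> = (\<integral>y. f y * cnj (kop M (adj k) g y) \<partial>M)"
  proof (rule Bochner_Integration.integral_cong[OF refl])
    fix y
    have "(\<integral>x. k x y * f y * cnj (g x) \<partial>M) = (\<integral>x. f y * (k x y * cnj (g x)) \<partial>M)"
      by (simp add: mult_ac)
    also have "\<dots> = f y * (\<integral>x. k x y * cnj (g x) \<partial>M)"
      by simp
    also have "(\<integral>x. k x y * cnj (g x) \<partial>M) = cnj (kop M (adj k) g y)"
      unfolding kop_def Bochner_Integration.integral_cnj[symmetric] by (simp add: adj_def)
    finally show "(\<integral>x. k x y * f y * cnj (g x) \<partial>M) = f y * cnj (kop M (adj k) g y)" .
  qed
  finally show ?thesis by (simp add: ip_def)
qed

lemma nsq_bound:
  assumes "\<And>x. x \<in> space M \<Longrightarrow> cmod (f x) \<le> C"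
  shows "nsq M f \<le> C\<^sup>2"
proof (cases "integrable M (\<lambda>x. (cmod (f x))\<^sup>2)")
  case True
  have "nsq M f \<le> (\<integral>x. C\<^sup>2 \<partial>M)" unfolding nsq_def
    using True assms by (intro integral_mono) (auto intro: power_mono)
  then show ?thesis by (simp add: prob_space)
next
  case False
  \<comment> \<open>The Bochner integral of a nonintegrable function is 0.\<close>
  then show ?thesis by (simp add: nsq_def not_integrable_integral_eq)
qed

text \<open>Bessel for the conjugated row at each \<open>x\<close> bounds the sum there, and
  integration over \<open>x\<close> keeps the bound. The sum is a part of the squared
  Hilbert-Schmidt norm. As the bound does not depend on \<open>I\<close>, it limits the number of
  orthonormal eigenfunctions for one eigenvalue and makes the sums over sets of eigenfunctions,
  maximised later, bounded.\<close>

lemma sum_nsq_kop_le: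
  assumes k: "bdd_kernel M k" and C: "\<And>x y. x \<in> space M \<Longrightarrow> y \<in> space M \<Longrightarrow> cmod (k x y) \<le> C"
    and o: "orthonormal M e I" and fin: "finite I"
  shows "(\<Sum>i\<in>I. nsq M (kop M k (e i))) \<le> C\<^sup>2"
proof -
  have e: "\<And>i. i \<in> I \<Longrightarrow> bdd_meas M (e i)" using o by (auto simp: orthonormal_def)
  have int: "\<And>i. i \<in> I \<Longrightarrow> integrable M (\<lambda>x. (cmod (kop M k (e i) x))\<^sup>2)"
    by (intro bdd_meas_integrable_nsq bdd_meas_kop k e)
  have "(\<Sum>i\<in>I. nsq M (kop M k (e i))) = (\<integral>x. (\<Sum>i\<in>I. (cmod (kop M k (e i) x))\<^sup>2) \<partial>M)"
    unfolding nsq_def using int by (subst Bochner_Integration.integral_sum) auto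
  also have "\<dots> \<le> (\<integral>x. C\<^sup>2 \<partial>M)"
  proof (rule integral_mono)
    show "integrable M (\<lambda>x. \<Sum>i\<in>I. (cmod (kop M k (e i) x))\<^sup>2)" using int by auto
    show "(\<Sum>i\<in>I. (cmod (kop M k (e i) x))\<^sup>2) \<le> C\<^sup>2" if x: "x \<in> space M" for x
    proof -
      have "(\<Sum>i\<in>I. (cmod (kop M k (e i) x))\<^sup>2) = (\<Sum>i\<in>I. (cmod (ip M (\<lambda>y. cnj (k x y)) (e i)))\<^sup>2)"
        unfolding kop_ip by (subst ip_cnj) simp
      also have "\<dots> \<le> nsq M (\<lambda>y. cnj (k x y))"
        by (intro Bessel o fin bdd_meas_cnj kernel_row k x)
      also have "\<dots> \<le> C\<^sup>2" using C x by (intro nsq_bound) auto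
      finally show ?thesis .
    qed
  qed auto
  finally show ?thesis by (simp add: prob_space)
qed

end

section \<open>Eigenfunctions of \<open>K\<^sup>* K\<close>\<close>

definition ksq :: "'a measure \<Rightarrow> ('a \<Rightarrow> 'a \<Rightarrow> complex) \<Rightarrow> ('a \<Rightarrow> complex) \<Rightarrow> 'a \<Rightarrow> complex" where
  "ksq M k f = kop M (adj k) (kop M k f)"

text \<open>The column at \<open>x\<close> of the kernel of \<open>K\<^sup>* K\<close>. Evaluating
  \<open>ksq M k f\<close> at \<open>x\<close> is taking the inner product with it
  (\<open>ksq_eq_ip\<close>).\<close>

definition kcol :: "'a measure \<Rightarrow> ('a \<Rightarrow> 'a \<Rightarrow> complex) \<Rightarrow> 'a \<Rightarrow> 'a \<Rightarrow> complex" where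
  "kcol M k x = kop M (adj k) (\<lambda>z. k z x)"

text \<open>Log-convexity makes the quotients \<open>q (Suc n) / q n\<close> nondecreasing, and
  \<open>q 0 \<le> 1\<close> makes the first of them at least \<open>q 1\<close>. The bound with
  \<open>L\<close> excludes \<open>q 0 = 0\<close> while \<open>q 1 > 0\<close>; the case
  \<open>n = 0\<close> is set apart because \<open>q 0\<close> may be below 1. The intended
  \<open>q n\<close> is the squared norm of the \<open>n\<close>-th iterate of a selfadjoint
  operator at a vector of norm at most 1.\<close>

lemma log_convex_power_le:
  fixes q :: "nat \<Rightarrow> real"
  assumes nn: "\<And>n. q n \<ge> 0" and q0: "q 0 \<le> 1" and qL: "q 1 \<le> L * q 0"
    and conv: "\<And>n. (q (Suc n))\<^sup>2 \<le> q n * q (Suc (Suc n))"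
  shows "q 1 ^ n \<le> q n \<or> n = 0"
proof (cases "q 1 = 0")
  case True
  then show ?thesis using nn[of n] by (cases n) auto
next
  case False
  then have pos1: "q 1 > 0" using nn[of 1] by linarith
  have pos0: "q 0 > 0"
  proof (rule ccontr)
    assume "\<not> q 0 > 0"
    then have "q 0 = 0" using nn[of 0] by linarith
    then show False using qL pos1 by simp
  qed
  have *: "q n > 0 \<and> q 1 * q n \<le> q (Suc n)" for n
  proof (induction n)
    case 0
    then show ?case using pos0 pos1 q0 by (simp add: mult_left_le)
  next
    case (Suc n)
    then have p: "q (Suc n) > 0" using pos1 by (meson less_le_trans mult_pos_pos)
    have "q n * (q 1 * q (Suc n)) = (q 1 * q n) * q (Suc n)" by simp
    also have "\<dots> \<le> q (Suc n) * q (Suc n)" using Suc p by (intro mult_right_mono) auto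
    also have "\<dots> \<le> q n * q (Suc (Suc n))" using conv[of n] by (simp add: power2_eq_square)
    finally show ?case using p Suc by simp
  qed
  have "q 1 ^ Suc n \<le> q (Suc n)" for n
  proof (induction n)
    case (Suc n)
    have "q 1 ^ Suc (Suc n) \<le> q 1 * q (Suc n)" using Suc pos1 by simp
    also have "\<dots> \<le> q (Suc (Suc n))" using * by blast
    finally show ?case .
  qed simp
  then show ?thesis by (cases n) auto
qed

context prob_space
begin

lemma bdd_meas_ksq: "bdd_kernel M k \<Longrightarrow> bdd_meas M f \<Longrightarrow> bdd_meas M (ksq M k f)"
  unfolding ksq_def by (intro bdd_meas_kop kernel_adj)

lemma bdd_meas_ksq_pow: "bdd_kernel M k \<Longrightarrow> bdd_meas M f \<Longrightarrow> bdd_meas M ((ksq M k ^^ n) f)"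
  by (induction n) (auto intro: bdd_meas_ksq)

lemma kernel_col: "bdd_kernel M k \<Longrightarrow> x \<in> space M \<Longrightarrow> bdd_meas M (\<lambda>z. k z x)"
  using bdd_meas_cnj[OF kernel_row[OF kernel_adj, of k x]] by (simp add: adj_def)

lemma bdd_meas_kcol: "bdd_kernel M k \<Longrightarrow> x \<in> space M \<Longrightarrow> bdd_meas M (kcol M k x)"
  unfolding kcol_def by (intro bdd_meas_kop kernel_adj kernel_col)

lemma ksq_eq_ip:
  assumes "bdd_kernel M k" "x \<in> space M" "bdd_meas M f"
  shows "ksq M k f x = ip M f (kcol M k x)"
proof -
  have "ksq M k f x = ip M (kop M k f) (\<lambda>z. k z x)"
    unfolding ksq_def kop_ip[of "adj k"] by (simp add: adj_def)
  also have "\<dots> = ip M f (kcol M k x)"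
    unfolding kcol_def using assms by (intro kop_adjoint[of k] kernel_col[of k])
  finally show ?thesis .
qed

lemma ksq_ip_kop: "bdd_kernel M k \<Longrightarrow> bdd_meas M f \<Longrightarrow> bdd_meas M g \<Longrightarrow>
    ip M (ksq M k f) g = ip M (kop M k f) (kop M k g)"
  unfolding ksq_def using kop_adjoint[OF kernel_adj, of k "kop M k f" g] bdd_meas_kop by simp

lemma ksq_selfadjoint: "bdd_kernel M k \<Longrightarrow> bdd_meas M f \<Longrightarrow> bdd_meas M g \<Longrightarrow>
    ip M (ksq M k f) g = ip M f (ksq M k g)"
  by (subst (2) ip_cnj) (simp add: ksq_ip_kop ip_cnj[of M "kop M k g" "kop M k f"])

lemma ksq_pow_selfadjoint:
  assumes k: "bdd_kernel M k" and "bdd_meas M f" "bdd_meas M g"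
  shows "ip M ((ksq M k ^^ n) f) g = ip M f ((ksq M k ^^ n) g)"
  using assms(3)
proof (induction n arbitrary: g)
  case (Suc n)
  have "ip M ((ksq M k ^^ Suc n) f) g = ip M ((ksq M k ^^ n) f) (ksq M k g)"
    using k assms(2) Suc by (simp add: ksq_selfadjoint bdd_meas_ksq_pow)
  also have "\<dots> = ip M f ((ksq M k ^^ n) (ksq M k g))"
    by (rule Suc) (simp add: bdd_meas_ksq k Suc)
  finally show ?case by (simp add: funpow_swap1)
qed simp

lemma ksq_diff: "bdd_kernel M k \<Longrightarrow> x \<in> space M \<Longrightarrow> bdd_meas M f \<Longrightarrow> bdd_meas M g \<Longrightarrow>
    ksq M k (\<lambda>y. f y - g y) x = ksq M k f x - ksq M k g x"
  by (simp add: ksq_eq_ip bdd_meas_diff ip_diff_left bdd_meas_kcol)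

lemma ksq_scale: "ksq M k (\<lambda>y. c * f y) x = c * ksq M k f x"
  unfolding ksq_def by (simp add: kop_scale[abs_def] kop_scale)

lemma kernel_kcol_bound:
  assumes k: "bdd_kernel M k"
  obtains D where "D > 0" "\<And>x. x \<in> space M \<Longrightarrow> nsq M (kcol M k x) \<le> D"
proof -
  obtain C where C: "\<And>x y. x \<in> space M \<Longrightarrow> y \<in> space M \<Longrightarrow> cmod (k x y) \<le> C"
    using k unfolding bdd_kernel_def by metis
  \<comment> \<open>The added 1 makes the bound positive, since a later choice of constants divides
    by it.\<close>
  have "nsq M (kcol M k x) \<le> (C * C)\<^sup>2 + 1" if x: "x \<in> space M" for x
  proof -
    have "cmod (kcol M k x y) \<le> C * C" if y: "y \<in> space M" for y
    proof -
      have "cmod (kcol M k x y) ^ 2 \<le> nsq M (\<lambda>z. k z x) * nsq M (\<lambda>z. k z y)"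
        unfolding kcol_def kop_ip adj_def complex_cnj_cnj
        by (intro Cauchy_Schwarz_ip kernel_col k x y)
      also have "\<dots> \<le> C\<^sup>2 * C\<^sup>2" using C x y by (intro mult_mono nsq_bound) auto
      finally have "cmod (kcol M k x y) ^ 2 \<le> (C * C) ^ 2" by (simp add: power_mult_distrib)
      moreover have "0 \<le> C * C" by simp
      ultimately show ?thesis by (rule power2_le_imp_le)
    qed
    then have "nsq M (kcol M k x) \<le> (C * C)\<^sup>2" by (rule nsq_bound)
    then show ?thesis by simp
  qed
  moreover have "(C * C)\<^sup>2 + 1 > 0" by (simp add: add_nonneg_pos)
  ultimately show ?thesis using that by blast
qed

lemma measurable_kop_param:
  assumes k: "bdd_kernel M k" and F: "case_prod F \<in> borel_measurable (M \<Otimes>\<^sub>M M)"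
  shows "(\<lambda>(x, y). kop M k (F x) y) \<in> borel_measurable (M \<Otimes>\<^sub>M M)"
proof -
  have [measurable]: "case_prod k \<in> borel_measurable (M \<Otimes>\<^sub>M M)" "case_prod F \<in> borel_measurable (M \<Otimes>\<^sub>M M)"
    using k F by (simp_all add: bdd_kernel_def)
  show ?thesis unfolding kop_def by measurable
qed

text \<open>Joint measurability is what allows the squared norms of these iterates to be integrated
  over \<open>x\<close>. Each step of the induction is one use of
  \<open>measurable_kop_param\<close> for \<open>k\<close> and one for \<open>adj k\<close>.\<close>

lemma measurable_ksq_pow_kcol:
  assumes k: "bdd_kernel M k"
  shows "(\<lambda>(x, y). (ksq M k ^^ n) (kcol M k x) y) \<in> borel_measurable (M \<Otimes>\<^sub>M M)"
proof (induction n)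
  case 0
  have [measurable]: "case_prod k \<in> borel_measurable (M \<Otimes>\<^sub>M M)" using k by (simp add: bdd_kernel_def)
  have "case_prod (\<lambda>x z. k z x) \<in> borel_measurable (M \<Otimes>\<^sub>M M)" by measurable
  from measurable_kop_param[OF kernel_adj[OF k] this] show ?case by (simp add: kcol_def)
next
  case (Suc n)
  from measurable_kop_param[OF kernel_adj[OF k] measurable_kop_param[OF k Suc, unfolded case_prod_beta'[symmetric]]]
  show ?case by (simp add: ksq_def)
qed

text \<open>Write \<open>A\<close> for \<open>ksq M k\<close>, of operator norm \<open>\<surd>L\<close>. If all the limits vanished, the Hilbert--Schmidt norms of
  \<open>A ^^ n\<close>, divided by \<open>(\<surd>L)^n\<close>, would tend to zero by dominated convergence; but they dominate
  the normalised operator norms, which are \<open>1\<close> because \<open>A\<close> is selfadjoint.\<close>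
lemma nsq_ksq_pow_kcol_not_null:
  assumes k: "bdd_kernel M k" and L: "L > 0"
    and le: "\<And>f. bdd_meas M f \<Longrightarrow> nsq M (ksq M k f) \<le> L * nsq M f"
    and sup: "\<And>c. c < L \<Longrightarrow> \<exists>f. bdd_meas M f \<and> nsq M f \<le> 1 \<and> nsq M (ksq M k f) > c"
  shows "\<exists>x\<in>space M. \<not> (\<lambda>n. nsq M ((ksq M k ^^ n) (kcol M k x)) / L ^ n) \<longlonglongrightarrow> 0"
proof (rule ccontr)
  assume "\<not> ?thesis"
  then have lim: "\<And>x. x \<in> space M \<Longrightarrow> (\<lambda>n. nsq M ((ksq M k ^^ n) (kcol M k x)) / L ^ n) \<longlonglongrightarrow> 0"
    by blast
  obtain D where D: "D > 0" "\<And>x. x \<in> space M \<Longrightarrow> nsq M (kcol M k x) \<le> D"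
    using kernel_kcol_bound[OF k] by blast
  define N where "N n x = nsq M ((ksq M k ^^ n) (kcol M k x))" for n x
  have N_meas [measurable]: "N n \<in> borel_measurable M" for n
  proof -
    have [measurable]: "(\<lambda>(x, y). (ksq M k ^^ n) (kcol M k x) y) \<in> borel_measurable (M \<Otimes>\<^sub>M M)"
      by (rule measurable_ksq_pow_kcol[OF k])
    show ?thesis unfolding N_def nsq_def by measurable
  qed
  have N_le: "N n x \<le> D * L ^ n" if x: "x \<in> space M" for n x
  proof (induction n)
    case 0
    then show ?case using D(2)[OF x] by (simp add: N_def)
  next
    case (Suc n)
    have "N (Suc n) x \<le> L * N n x" unfolding N_def
      by (simp add: le bdd_meas_ksq_pow bdd_meas_kcol k x)
    also have "\<dots> \<le> L * (D * L ^ n)" using Suc L by (intro mult_left_mono) auto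
    finally show ?case by (simp add: mult_ac)
  qed
  have N_nn: "0 \<le> N n x" for n x by (simp add: N_def)
  have lim_int: "(\<lambda>n. \<integral>x. N n x / L ^ n \<partial>M) \<longlonglongrightarrow> (\<integral>x. 0 \<partial>M)"
  proof (rule integral_dominated_convergence[where w = "\<lambda>x. D"])
    show "AE x in M. (\<lambda>n. N n x / L ^ n) \<longlonglongrightarrow> 0" using lim by (auto simp: N_def)
    show "AE x in M. norm (N n x / L ^ n) \<le> D" for n
      using N_le[of _ n] N_nn[of n] L by (auto simp: field_simps)
  qed auto
  \<comment> \<open>\<open>N n\<close> controls \<open>Suc n\<close> applications of the operator,
    one of them being spent on evaluation at \<open>x\<close>; hence the bound \<open>L / 2\<close>
    instead of \<open>1 / 2\<close>.\<close>
  have "\<forall>\<^sub>F n in sequentially. (\<integral>x. N n x / L ^ n \<partial>M) < L / 2"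
    using lim_int L by (intro order_tendstoD(2)[where y = 0]) auto
  then obtain n where n: "(\<integral>x. N n x / L ^ n \<partial>M) < L / 2"
    by (auto simp: eventually_sequentially)
  have N_int: "integrable M (N n)"
    using N_le[of _ n] N_nn[of n] by (intro integrable_const_bound[where B = "D * L ^ n"]) auto
  have bound: "nsq M (ksq M k f) ^ Suc n \<le> L ^ Suc n / 2" if f: "bdd_meas M f" "nsq M f \<le> 1" for f
  proof -
    define q where "q n = nsq M ((ksq M k ^^ n) f)" for n
    have b: "bdd_meas M ((ksq M k ^^ n) f)" for n by (simp add: bdd_meas_ksq_pow k f)
    have conv: "(q (Suc n))\<^sup>2 \<le> q n * q (Suc (Suc n))" for n
    proof -
      have "of_real (q (Suc n)) = ip M ((ksq M k ^^ n) f) ((ksq M k ^^ Suc (Suc n)) f)"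
        unfolding q_def ip_self[symmetric] using b[of n] b[of "Suc n"] by (simp add: ksq_selfadjoint k)
      then have "(q (Suc n))\<^sup>2 = (cmod (ip M ((ksq M k ^^ n) f) ((ksq M k ^^ Suc (Suc n)) f)))\<^sup>2"
        by (metis norm_of_real power2_abs)
      also have "\<dots> \<le> q n * q (Suc (Suc n))" unfolding q_def by (intro Cauchy_Schwarz_ip b)
      finally show ?thesis .
    qed
    have "q 1 ^ Suc n \<le> q (Suc n)"
      using log_convex_power_le[of q L "Suc n"] conv f le[OF f(1)] by (auto simp: q_def)
    also have "q (Suc n) \<le> (\<integral>x. N n x \<partial>M)" unfolding q_def nsq_def
    proof (rule integral_mono)
      show "integrable M (\<lambda>x. (cmod ((ksq M k ^^ Suc n) f x))\<^sup>2)"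
        by (intro bdd_meas_integrable_nsq b)
      fix x assume x: "x \<in> space M"
      have "(ksq M k ^^ Suc n) f x = ip M ((ksq M k ^^ n) f) (kcol M k x)"
        using b[of n] by (simp add: ksq_eq_ip k x)
      also have "\<dots> = ip M f ((ksq M k ^^ n) (kcol M k x))"
        by (intro ksq_pow_selfadjoint k f bdd_meas_kcol x)
      finally have "(cmod ((ksq M k ^^ Suc n) f x))\<^sup>2 \<le> nsq M f * N n x"
        unfolding N_def using Cauchy_Schwarz_ip[OF f(1) bdd_meas_ksq_pow[OF k bdd_meas_kcol[OF k x], of n]]
        by simp
      also have "\<dots> \<le> 1 * N n x" using f(2) by (intro mult_right_mono) (auto simp: N_def)
      finally show "(cmod ((ksq M k ^^ Suc n) f x))\<^sup>2 \<le> N n x" by simp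
    qed (rule N_int)
    also have "(\<integral>x. N n x \<partial>M) \<le> L ^ Suc n / 2"
      using n L by (simp add: field_simps)
    finally show ?thesis by (simp add: q_def)
  qed
  \<comment> \<open>By \<open>bound\<close>, no \<open>f\<close> with \<open>nsq M f \<le> 1\<close>
    is mapped to squared norm above \<open>r * L\<close>; since \<open>r < 1\<close>, this
    contradicts \<open>sup\<close>.\<close>
  define r where "r = root (Suc n) (1 / 2)"
  have r: "0 < r" "r < 1" "r ^ Suc n = 1 / 2"
    unfolding r_def by (auto simp: real_root_lt_1_iff simp del: power_Suc)
  then have "r * L < L" using L by simp
  then obtain f where f: "bdd_meas M f" "nsq M f \<le> 1" "nsq M (ksq M k f) > r * L" using sup by blast
  have "(r * L) ^ Suc n < nsq M (ksq M k f) ^ Suc n"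
    using f(3) r L by (intro power_strict_mono) auto
  also have "\<dots> \<le> L ^ Suc n / 2" by (rule bound[OF f(1,2)])
  finally show False using r by (simp add: power_mult_distrib del: power_Suc)
qed

text \<open>Evaluation at a point is an inner product with \<open>kcol\<close>, whose norms are
  uniformly bounded. For images under \<open>ksq\<close> this upgrades L2 estimates to uniform ones,
  and makes the image of a null function vanish at every point.\<close>

lemma ksq_bound:
  assumes k: "bdd_kernel M k" and D: "\<And>x. x \<in> space M \<Longrightarrow> nsq M (kcol M k x) \<le> D"
    and f: "bdd_meas M f" and x: "x \<in> space M"
  shows "(cmod (ksq M k f x))\<^sup>2 \<le> D * nsq M f"
proof -
  have "(cmod (ksq M k f x))\<^sup>2 \<le> nsq M f * nsq M (kcol M k x)"
    unfolding ksq_eq_ip[OF k x f] by (intro Cauchy_Schwarz_ip f bdd_meas_kcol k x)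
  also have "\<dots> \<le> nsq M f * D" using D[OF x] by (intro mult_left_mono) auto
  finally show ?thesis by (simp add: mult.commute)
qed

text \<open>\<open>L\<close> is the square of the operator norm of \<open>ksq M k\<close>, taken as
  a supremum over the unit ball of the bounded functions. It is only approached here; that it comes
  from an eigenfunction is a separate matter.\<close>

lemma ksq_norm_exists:
  assumes k: "bdd_kernel M k"
  obtains L where "L \<ge> 0" "\<And>f. bdd_meas M f \<Longrightarrow> nsq M (ksq M k f) \<le> L * nsq M f"
    "\<And>c. c < L \<Longrightarrow> \<exists>f. bdd_meas M f \<and> nsq M f \<le> 1 \<and> nsq M (ksq M k f) > c"
proof -
  obtain D where D: "D > 0" "\<And>x. x \<in> space M \<Longrightarrow> nsq M (kcol M k x) \<le> D"
    using kernel_kcol_bound[OF k] by blast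
  have nsq_le: "nsq M (ksq M k f) \<le> D * nsq M f" if f: "bdd_meas M f" for f
  proof -
    have "cmod (ksq M k f x) \<le> sqrt (D * nsq M f)" if "x \<in> space M" for x
      using ksq_bound[OF k D(2) f that] by (simp add: real_le_rsqrt)
    then have "nsq M (ksq M k f) \<le> (sqrt (D * nsq M f))\<^sup>2" by (rule nsq_bound)
    then show ?thesis using D by simp
  qed
  define S where "S = {nsq M (ksq M k f) | f. bdd_meas M f \<and> nsq M f \<le> 1}"
  define L where "L = Sup S"
  have bdd: "bdd_above S"
  proof (rule bdd_aboveI)
    fix s assume "s \<in> S"
    then obtain f where f: "s = nsq M (ksq M k f)" "bdd_meas M f" "nsq M f \<le> 1" by (auto simp: S_def)
    have "D * nsq M f \<le> D * 1" using D f by (intro mult_left_mono) auto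
    then show "s \<le> D" using nsq_le[OF f(2)] f by simp
  qed
  have "nsq M (ksq M k (\<lambda>x. 0)) \<in> S" unfolding S_def using bdd_meas_const by (fastforce simp: nsq_def)
  then have ne: "S \<noteq> {}" by auto
  have L0: "L \<ge> 0"
    using cSup_upper[OF \<open>nsq M (ksq M k (\<lambda>x. 0)) \<in> S\<close> bdd] nsq_nonneg order_trans unfolding L_def by blast
  have "nsq M (ksq M k f) \<le> L * nsq M f" if f: "bdd_meas M f" for f
  proof (cases "nsq M f = 0")
    case True
    then show ?thesis using nsq_le[OF f] nsq_nonneg[of M "ksq M k f"] by simp
  next
    case False
    then have pos: "nsq M f > 0" using nsq_nonneg[of M f] by linarith
    define c where "c = complex_of_real (1 / sqrt (nsq M f))"
    have c: "(cmod c)\<^sup>2 = 1 / nsq M f" using pos by (simp add: c_def norm_divide power_divide)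
    have "nsq M (ksq M k (\<lambda>x. c * f x)) \<in> S"
      unfolding S_def using f pos by (auto simp: nsq_scale c intro!: bdd_meas_cmult)
    then have "nsq M (ksq M k (\<lambda>x. c * f x)) \<le> L" unfolding L_def by (intro cSup_upper bdd)
    moreover have "nsq M (ksq M k (\<lambda>x. c * f x)) = nsq M (ksq M k f) / nsq M f"
      unfolding ksq_scale[abs_def] nsq_scale c by simp
    ultimately show ?thesis using pos by (simp add: field_simps)
  qed
  moreover have "\<exists>f. bdd_meas M f \<and> nsq M f \<le> 1 \<and> nsq M (ksq M k f) > c" if "c < L" for c
    using less_cSupD[OF ne that[unfolded L_def]] by (auto simp: S_def)
  ultimately show ?thesis using that L0 by blast
qed

text \<open>With \<open>A\<close> for \<open>ksq M k\<close>, the inner product of \<open>A\<^sup>2\<^sup>n a / L^n\<close> and \<open>A\<^sup>2\<^sup>m a / L^m\<close> is a decreasing function of \<open>n + m\<close>,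
  so these vectors form a Cauchy sequence in \<open>L\<^sup>2\<close>; applying \<open>A\<^sup>2\<close> makes it uniformly Cauchy.\<close>
lemma ksq_sq_eigenfunction_exists:
  assumes k: "bdd_kernel M k" and L: "L > 0"
    and le: "\<And>f. bdd_meas M f \<Longrightarrow> nsq M (ksq M k f) \<le> L * nsq M f"
    and x0: "x0 \<in> space M"
    and notlim: "\<not> (\<lambda>n. nsq M ((ksq M k ^^ n) (kcol M k x0)) / L ^ n) \<longlonglongrightarrow> 0"
  obtains v where "bdd_meas M v" "nsq M v > 0"
    "\<And>x. x \<in> space M \<Longrightarrow> ksq M k (ksq M k v) x = of_real L * v x"
proof -
  obtain D where D: "D > 0" "\<And>x. x \<in> space M \<Longrightarrow> nsq M (kcol M k x) \<le> D"
    using kernel_kcol_bound[OF k] by blast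
  define A where "A = ksq M k"
  define a where "a = kcol M k x0"
  define b where "b n = nsq M ((A ^^ n) a) / L ^ n" for n
  define u where "u n = (\<lambda>x. of_real (1 / L ^ n) * (A ^^ (2 * n)) a x)" for n
  have Abdd: "\<And>f. bdd_meas M f \<Longrightarrow> bdd_meas M (A f)" unfolding A_def by (rule bdd_meas_ksq[OF k])
  have Apow: "\<And>n. bdd_meas M ((A ^^ n) a)"
    unfolding A_def a_def by (intro bdd_meas_ksq_pow bdd_meas_kcol k x0)
  have ubdd: "bdd_meas M (u n)" for n unfolding u_def by (intro bdd_meas_cmult Apow)
  have A_le: "nsq M (A f) \<le> L * nsq M f" if "bdd_meas M f" for f using le that by (simp add: A_def)
  have A_bound: "(cmod (A f x))\<^sup>2 \<le> D * nsq M f" if "bdd_meas M f" "x \<in> space M" for f x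
    unfolding A_def using k D(2) that by (rule ksq_bound)
  have A_diff: "A (\<lambda>y. f y - g y) x = A f x - A g x" if "bdd_meas M f" "bdd_meas M g" "x \<in> space M" for f g x
    unfolding A_def using k that by (simp add: ksq_diff)
  have AA_bound: "(cmod (A (A f) x - A (A g) x))\<^sup>2 \<le> D * L * nsq M (\<lambda>x. f x - g x)"
    if fg: "bdd_meas M f" "bdd_meas M g" "x \<in> space M" for f g x
  proof -
    have "A (A f) x - A (A g) x = A (\<lambda>y. A f y - A g y) x" using fg by (simp add: A_diff Abdd)
    then have "(cmod (A (A f) x - A (A g) x))\<^sup>2 \<le> D * nsq M (\<lambda>y. A f y - A g y)"
      using A_bound fg by (simp add: Abdd bdd_meas_diff)
    also have "nsq M (\<lambda>y. A f y - A g y) = nsq M (A (\<lambda>y. f y - g y))"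
      using fg by (intro nsq_cong) (simp add: A_diff)
    also have "D * \<dots> \<le> D * (L * nsq M (\<lambda>y. f y - g y))"
      using D fg by (intro mult_left_mono A_le bdd_meas_diff) auto
    finally show ?thesis by simp
  qed
  have b_dec: "b (Suc n) \<le> b n" for n
  proof -
    have "nsq M (A ((A ^^ n) a)) \<le> L * nsq M ((A ^^ n) a)" by (intro A_le Apow)
    then show ?thesis using L by (simp add: b_def field_simps)
  qed
  have b_nn: "b n \<ge> 0" for n using L by (simp add: b_def)
  have b_decseq: "decseq b" by (rule decseq_SucI) (rule b_dec)
  then obtain l where l: "b \<longlonglongrightarrow> l" "\<And>n. l \<le> b n"
    using decseq_convergent[of b 0] b_nn by metis
  have "l \<noteq> 0" using notlim l(1) by (auto simp: b_def[abs_def] A_def a_def)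
  moreover have "l \<ge> 0" using b_nn by (intro LIMSEQ_le_const[OF l(1)]) auto
  ultimately have l_pos: "l > 0" by simp
  have ip_u: "ip M (u n) (u m) = of_real (b (n + m))" for n m
  proof -
    have "ip M ((A ^^ (2 * n)) a) ((A ^^ (2 * m)) a) = ip M ((A ^^ (n + m)) a) ((A ^^ (n + m)) a)"
    proof -
      have "ip M ((A ^^ (2 * n)) a) ((A ^^ (2 * m)) a) = ip M a ((A ^^ (2 * n)) ((A ^^ (2 * m)) a))"
        using ksq_pow_selfadjoint[OF k, of a "(A ^^ (2 * m)) a" "2 * n"] Apow[of 0] Apow[of "2 * m"]
        by (simp add: A_def)
      also have "(A ^^ (2 * n)) ((A ^^ (2 * m)) a) = (A ^^ (n + m)) ((A ^^ (n + m)) a)"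
      proof -
        have "(A ^^ (2 * n)) ((A ^^ (2 * m)) a) = (A ^^ (2 * n + 2 * m)) a" by (simp add: funpow_add)
        also have "2 * n + 2 * m = (n + m) + (n + m)" by simp
        also have "(A ^^ ((n + m) + (n + m))) a = (A ^^ (n + m)) ((A ^^ (n + m)) a)"
          by (simp only: funpow_add o_apply)
        finally show ?thesis .
      qed
      also have "ip M a \<dots> = ip M ((A ^^ (n + m)) a) ((A ^^ (n + m)) a)"
        using ksq_pow_selfadjoint[OF k, of a "(A ^^ (n + m)) a" "n + m"] Apow[of 0] Apow[of "n + m"]
        by (simp add: A_def)
      finally show ?thesis .
    qed
    then show ?thesis
      unfolding u_def ip_scale_left ip_scale_right ip_self b_def by (simp add: power_add)
  qed
  have nsq_u: "nsq M (u n) = b (2 * n)" for n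
    using ip_u[of n n] by (simp add: ip_self mult_2)
  have nsq_u_diff: "nsq M (\<lambda>x. u n x - u m x) = b (2 * n) + b (2 * m) - 2 * b (n + m)" for n m
    by (simp add: nsq_diff ubdd nsq_u ip_u)
  \<comment> \<open>Applying \<open>A\<close> twice moves the sequence by one index, up to the
    factor \<open>L\<close>. So the same operation makes the sequence uniformly Cauchy and turns its
    limit into an eigenfunction.\<close>
  have u_Suc: "A (A (u n)) x = of_real L * u (Suc n) x" for n x
  proof -
    have scale: "A (A (\<lambda>x. c * h x)) x = c * A (A h) x" for c h
      unfolding A_def by (simp add: ksq_scale[abs_def] ksq_scale)
    have "A (A (u n)) x = of_real (1 / L ^ n) * (A ^^ (2 * Suc n)) a x"
      unfolding u_def scale by simp
    then show ?thesis using L by (simp add: u_def field_simps)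
  qed
  have "uniformly_Cauchy_on (space M) (\<lambda>n. u (Suc n))"
  proof (rule uniformly_Cauchy_onI)
    fix e :: real assume e: "e > 0"
    \<comment> \<open>\<open>AA_bound\<close> costs the factor \<open>D * L\<close> and
      \<open>u_Suc\<close> a factor \<open>L\<close> before squaring; \<open>d\<close> is chosen so
      that \<open>D * L * (4 * d)\<close> is exactly \<open>(e * L)\<^sup>2\<close>.\<close>
    define d where "d = (e * L)\<^sup>2 / (4 * D * L)"
    have d: "d > 0" using e L D by (simp add: d_def)
    then have "\<forall>\<^sub>F n in sequentially. dist (b n) l < d" using l(1) by (rule tendstoD[rotated])
    then obtain N where N: "\<And>n. n \<ge> N \<Longrightarrow> \<bar>b n - l\<bar> < d" by (auto simp: eventually_sequentially dist_real_def)
    have "cmod (u (Suc m) x - u (Suc n) x) < e" if x: "x \<in> space M" and mn: "m \<ge> N" "n \<ge> N" for x m n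
    proof -
      have "nsq M (\<lambda>x. u m x - u n x) < 4 * d"
        unfolding nsq_u_diff using N[of "2 * m"] N[of "2 * n"] l(2)[of "m + n"] mn by simp
      then have "D * L * nsq M (\<lambda>x. u m x - u n x) < D * L * (4 * d)"
        using D L by (intro mult_strict_left_mono) auto
      moreover have "D * L * (4 * d) = (e * L)\<^sup>2" unfolding d_def using D L by simp
      ultimately have "(cmod (A (A (u m)) x - A (A (u n)) x))\<^sup>2 < (e * L)\<^sup>2"
        using AA_bound[OF ubdd ubdd x, of m n] by simp
      then have "cmod (A (A (u m)) x - A (A (u n)) x) < e * L"
        using e L by (simp add: power_less_imp_less_base)
      moreover have "A (A (u m)) x - A (A (u n)) x = of_real L * (u (Suc m) x - u (Suc n) x)"
        by (simp add: u_Suc right_diff_distrib)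
      ultimately show ?thesis using L by (simp add: norm_mult mult.commute)
    qed
    then show "\<exists>N. \<forall>x\<in>space M. \<forall>m\<ge>N. \<forall>n\<ge>N. dist (u (Suc m) x) (u (Suc n) x) < e"
      unfolding dist_norm by blast
  qed
  then obtain v where v: "uniform_limit (space M) (\<lambda>n. u (Suc n)) v sequentially"
    using Cauchy_uniformly_convergent uniformly_convergent_on_def by blast
  have v_ptw: "(\<lambda>n. u (Suc n) x) \<longlonglongrightarrow> v x" if "x \<in> space M" for x
    using v that by (rule tendsto_uniform_limitI)
  have v_meas: "v \<in> borel_measurable M"
    by (rule borel_measurable_LIMSEQ_metric[of "\<lambda>n. u (Suc n)"]) (auto intro: bdd_meas_measurable ubdd v_ptw)
  have unif: "\<exists>N. \<forall>n\<ge>N. \<forall>x\<in>space M. cmod (u (Suc n) x - v x) < e" if "e > 0" for e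
    using uniform_limitD[OF v that] by (auto simp: eventually_sequentially dist_norm)
  have v_bdd: "bdd_meas M v"
  proof -
    obtain N where N: "\<forall>x\<in>space M. cmod (u (Suc N) x - v x) < 1" using unif[of 1] by auto
    obtain C where C: "\<forall>x\<in>space M. cmod (u (Suc N) x) \<le> C" using ubdd[of "Suc N"] by (auto simp: bdd_meas_def)
    have "cmod (v x) \<le> C + 1" if x: "x \<in> space M" for x
    proof -
      have "cmod (v x) \<le> cmod (u (Suc N) x) + cmod (u (Suc N) x - v x)"
        by (metis add.commute norm_minus_commute norm_triangle_sub)
      then show ?thesis using N C x by fastforce
    qed
    then show ?thesis using v_meas by (auto simp: bdd_meas_def)
  qed
  have diff_lim: "(\<lambda>n. nsq M (\<lambda>x. u (Suc n) x - v x)) \<longlonglongrightarrow> 0"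
  proof (rule LIMSEQ_I)
    fix e :: real assume e: "e > 0"
    obtain N where N: "\<forall>n\<ge>N. \<forall>x\<in>space M. cmod (u (Suc n) x - v x) < sqrt (e / 2)"
      using unif[of "sqrt (e / 2)"] e by auto
    have "nsq M (\<lambda>x. u (Suc n) x - v x) < e" if "n \<ge> N" for n
    proof -
      have "nsq M (\<lambda>x. u (Suc n) x - v x) \<le> (sqrt (e / 2))\<^sup>2"
        by (rule nsq_bound) (use N that in \<open>auto simp: less_imp_le\<close>)
      then show ?thesis using e by simp
    qed
    then show "\<exists>N. \<forall>n\<ge>N. norm (nsq M (\<lambda>x. u (Suc n) x - v x) - 0) < e" by auto
  qed
  have "nsq M v > 0"
  proof (rule ccontr)
    assume "\<not> nsq M v > 0"
    then have 0: "nsq M v = 0" using nsq_nonneg[of M v] by linarith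
    \<comment> \<open>Since a null \<open>v\<close> is orthogonal to everything, this squared
      distance would be the squared norm of \<open>u (Suc n)\<close>, which is a value of
      \<open>b\<close>.\<close>
    have "nsq M (\<lambda>x. u (Suc n) x - v x) \<ge> l" for n
    proof -
      have "(cmod (ip M (u (Suc n)) v))\<^sup>2 \<le> 0"
        using Cauchy_Schwarz_ip[OF ubdd[of "Suc n"] v_bdd] 0 by simp
      then have "ip M (u (Suc n)) v = 0" by simp
      then show ?thesis using l(2)[of "2 * Suc n"] by (simp add: nsq_diff ubdd v_bdd 0 nsq_u)
    qed
    then have "l \<le> 0" using diff_lim by (intro LIMSEQ_le_const) auto
    then show False using l_pos by simp
  qed
  moreover have "A (A v) x = L * v x" if x: "x \<in> space M" for x
  proof -
    have "(\<lambda>n. (cmod (A (A (u (Suc n))) x - A (A v) x))\<^sup>2) \<longlonglongrightarrow> 0"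
    proof (rule tendsto_sandwich[where f = "\<lambda>_. 0"])
      show "\<forall>\<^sub>F n in sequentially. (cmod (A (A (u (Suc n))) x - A (A v) x))\<^sup>2
          \<le> D * L * nsq M (\<lambda>x. u (Suc n) x - v x)"
        using AA_bound[OF ubdd v_bdd x] by auto
      show "(\<lambda>n. D * L * nsq M (\<lambda>x. u (Suc n) x - v x)) \<longlonglongrightarrow> 0"
        using tendsto_mult_left[OF diff_lim, of "D * L"] by simp
    qed auto
    then have "(\<lambda>n. sqrt ((cmod (A (A (u (Suc n))) x - A (A v) x))\<^sup>2)) \<longlonglongrightarrow> sqrt 0"
      by (intro tendsto_real_sqrt)
    then have "(\<lambda>n. A (A (u (Suc n))) x) \<longlonglongrightarrow> A (A v) x"
      by (simp add: tendsto_norm_zero_iff LIM_zero_iff)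
    then have "(\<lambda>n. of_real L * u (Suc (Suc n)) x) \<longlonglongrightarrow> A (A v) x" by (simp add: u_Suc)
    moreover have "(\<lambda>n. of_real L * u (Suc (Suc n)) x) \<longlonglongrightarrow> of_real L * v x"
      by (intro tendsto_mult_left LIMSEQ_Suc[OF v_ptw[OF x]])
    ultimately show ?thesis by (rule LIMSEQ_unique)
  qed
  ultimately show ?thesis using that v_bdd unfolding A_def by blast
qed

text \<open>\<open>\<kappa>\<close> is the operator norm of \<open>A = ksq M k\<close>, the square
  root of \<open>L\<close>. Positivity of \<open>A\<close> passes from an eigenfunction of its
  square to one of \<open>A\<close> itself: if \<open>A (A v) = L v\<close>, then
  \<open>g = A v - \<kappa> v\<close> satisfies \<open>A g = - \<kappa> g\<close>, while the inner
  product of \<open>A g\<close> with \<open>g\<close> is the squared norm of \<open>K g\<close>.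
  Hence \<open>g\<close> is null, and by \<open>ksq_bound\<close> it vanishes at every
  point.\<close>

lemma ksq_eigenfunction_exists:
  assumes k: "bdd_kernel M k"
  obtains \<kappa> where "\<kappa> \<ge> 0" "\<And>f. bdd_meas M f \<Longrightarrow> nsq M (kop M k f) \<le> \<kappa> * nsq M f"
    "\<kappa> > 0 \<Longrightarrow> \<exists>v. bdd_meas M v \<and> nsq M v > 0 \<and> (\<forall>x\<in>space M. ksq M k v x = of_real \<kappa> * v x)"
proof -
  obtain L where L: "L \<ge> 0" "\<And>f. bdd_meas M f \<Longrightarrow> nsq M (ksq M k f) \<le> L * nsq M f"
    "\<And>c. c < L \<Longrightarrow> \<exists>f. bdd_meas M f \<and> nsq M f \<le> 1 \<and> nsq M (ksq M k f) > c"
    using ksq_norm_exists[OF k] by blast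
  define \<kappa> where "\<kappa> = sqrt L"
  have \<kappa>: "\<kappa> \<ge> 0" "\<kappa>\<^sup>2 = L" using L(1) by (auto simp: \<kappa>_def)
  have "nsq M (kop M k f) \<le> \<kappa> * nsq M f" if f: "bdd_meas M f" for f
  proof -
    have "of_real (nsq M (kop M k f)) = ip M (ksq M k f) f"
      by (simp add: ksq_ip_kop[OF k f f] ip_self)
    then have "(nsq M (kop M k f))\<^sup>2 = (cmod (ip M (ksq M k f) f))\<^sup>2"
      by (metis norm_of_real power2_abs)
    also have "\<dots> \<le> nsq M (ksq M k f) * nsq M f" by (intro Cauchy_Schwarz_ip bdd_meas_ksq k f)
    also have "\<dots> \<le> (L * nsq M f) * nsq M f" using L(2)[OF f] by (intro mult_right_mono) auto
    also have "\<dots> = (\<kappa> * nsq M f)\<^sup>2" by (simp add: \<kappa>(2)[symmetric] power2_eq_square)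
    finally show ?thesis by (rule power2_le_imp_le) (use \<kappa> in simp)
  qed
  moreover have "\<exists>v. bdd_meas M v \<and> nsq M v > 0 \<and> (\<forall>x\<in>space M. ksq M k v x = of_real \<kappa> * v x)" if pos: "\<kappa> > 0"
  proof -
    have L_pos: "L > 0" using pos L(1) by (simp add: \<kappa>_def)
    obtain x0 where x0: "x0 \<in> space M" "\<not> (\<lambda>n. nsq M ((ksq M k ^^ n) (kcol M k x0)) / L ^ n) \<longlonglongrightarrow> 0"
      using nsq_ksq_pow_kcol_not_null[OF k L_pos L(2,3)] by blast
    obtain v where v: "bdd_meas M v" "nsq M v > 0"
      "\<And>x. x \<in> space M \<Longrightarrow> ksq M k (ksq M k v) x = of_real L * v x"
      using ksq_sq_eigenfunction_exists[OF k L_pos L(2) x0] by blast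
    define g where "g = (\<lambda>x. ksq M k v x - \<kappa> * v x)"
    have g: "bdd_meas M g"
      unfolding g_def by (intro bdd_meas_diff bdd_meas_cmult bdd_meas_ksq k v(1))
    have Ag: "ksq M k g x = - \<kappa> * g x" if x: "x \<in> space M" for x
    proof -
      have "ksq M k g x = ksq M k (ksq M k v) x - ksq M k (\<lambda>y. \<kappa> * v y) x"
        unfolding g_def by (intro ksq_diff k x bdd_meas_ksq bdd_meas_cmult v(1))
      also have "\<dots> = of_real (\<kappa>\<^sup>2) * v x - \<kappa> * ksq M k v x"
        unfolding \<kappa>(2) ksq_scale v(3)[OF x] ..
      finally show ?thesis by (simp add: g_def algebra_simps power2_eq_square)
    qed
    have "of_real (nsq M (kop M k g)) = ip M (ksq M k g) g"
      by (simp add: ksq_ip_kop[OF k g g] ip_self)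
    also have "\<dots> = ip M (\<lambda>x. - \<kappa> * g x) g" by (intro ip_cong Ag) auto
    also have "\<dots> = of_real (- \<kappa> * nsq M g)" unfolding ip_scale_left ip_self by simp
    finally have "nsq M (kop M k g) = - \<kappa> * nsq M g" by (simp only: of_real_eq_iff)
    then have "\<kappa> * nsq M g \<le> 0" using nsq_nonneg[of M "kop M k g"] by linarith
    then have g0: "nsq M g = 0" using pos nsq_nonneg[of M g] by (simp add: mult_le_0_iff)
    obtain D where D: "D > 0" "\<And>x. x \<in> space M \<Longrightarrow> nsq M (kcol M k x) \<le> D"
      using kernel_kcol_bound[OF k] by blast
    have "g x = 0" if x: "x \<in> space M" for x
    proof -
      have "(cmod (ksq M k g x))\<^sup>2 \<le> 0" using ksq_bound[OF k D(2) g x] g0 by simp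
      then have "ksq M k g x = 0" by simp
      then show ?thesis using Ag[OF x] pos by simp
    qed
    then show ?thesis using v by (auto simp: g_def)
  qed
  ultimately show ?thesis using that \<kappa>(1) by blast
qed

end

section \<open>Kernels invariant under a measure preserving map\<close>

text \<open>\<open>q(U) w\<close> for the operator \<open>U w = w \<circ> T\<close>\<close>
definition pact :: "('a \<Rightarrow> 'a) \<Rightarrow> complex poly \<Rightarrow> ('a \<Rightarrow> complex) \<Rightarrow> 'a \<Rightarrow> complex" where
  "pact T q w x = (\<Sum>i\<le>degree q. coeff q i * w ((T ^^ i) x))"

lemma pact_eq: "degree q \<le> n \<Longrightarrow> pact T q w x = (\<Sum>i\<le>n. coeff q i * w ((T ^^ i) x))"
  unfolding pact_def by (intro sum.mono_neutral_left) (auto simp: coeff_eq_0)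

lemma pact_diff: "pact T (p - q) w x = pact T p w x - pact T q w x"
proof -
  define n where "n = max (degree p) (degree q)"
  have "degree (p - q) \<le> n" "degree p \<le> n" "degree q \<le> n" by (auto simp: n_def degree_diff_le)
  then show ?thesis by (simp add: pact_eq[of _ n] left_diff_distrib sum_subtractf)
qed

lemma pact_add: "pact T (p + q) w x = pact T p w x + pact T q w x"
proof -
  define n where "n = max (degree p) (degree q)"
  have "degree (p + q) \<le> n" "degree p \<le> n" "degree q \<le> n" by (auto simp: n_def degree_add_le)
  then show ?thesis by (simp add: pact_eq[of _ n] distrib_right sum.distrib)
qed

lemma pact_smult: "pact T (smult c q) w x = c * pact T q w x"
  by (simp add: pact_eq[of _ "degree q"] degree_smult_le sum_distrib_left mult.assoc)

lemma pact_0 [simp]: "pact T 0 w x = 0"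
  by (simp add: pact_def)

lemma pact_sum: "pact T (\<Sum>i\<in>I. p i) w x = (\<Sum>i\<in>I. pact T (p i) w x)"
  by (induction I rule: infinite_finite_induct) (auto simp: pact_add)

lemma pact_pCons_0: "pact T (pCons 0 q) w x = pact T q w (T x)"
  by (simp add: pact_eq[of "pCons 0 q" "Suc (degree q)"] degree_pCons_le pact_def
    sum.atMost_Suc_shift funpow_swap1 del: sum.atMost_Suc)

lemma pact_linear_factor: "pact T ([:- z, 1:] * q) w x = pact T q w (T x) - z * pact T q w x"
proof -
  have "[:- z, 1:] * q = pCons 0 q - smult z q" by simp
  then show ?thesis by (simp only: pact_diff pact_pCons_0 pact_smult)
qed

context prob_space
begin

lemma nsq_kop_eigenfunction:
  assumes k: "bdd_kernel M k" and v: "bdd_meas M v"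
    and ev: "\<And>x. x \<in> space M \<Longrightarrow> ksq M k v x = of_real \<kappa> * v x"
  shows "nsq M (kop M k v) = \<kappa> * nsq M v"
proof -
  have "of_real (nsq M (kop M k v)) = ip M (ksq M k v) v"
    by (simp add: ksq_ip_kop[OF k v v] ip_self)
  also have "\<dots> = ip M (\<lambda>x. \<kappa> * v x) v" by (intro ip_cong ev) auto
  also have "\<dots> = of_real (\<kappa> * nsq M v)" by (simp add: ip_scale_left ip_self)
  finally show ?thesis by (simp only: of_real_eq_iff)
qed

text \<open>A nonzero eigenvalue puts \<open>v\<close> into the range of \<open>ksq\<close>, where
  point values are bounded by the L2 norm. This keeps all eigenvalue equations valid at every point
  of the space and not only almost everywhere.\<close>

lemma ksq_eigenfunction_eq_0:
  assumes k: "bdd_kernel M k" and v: "bdd_meas M v" and "\<kappa> > 0"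
    and ev: "\<And>x. x \<in> space M \<Longrightarrow> ksq M k v x = of_real \<kappa> * v x"
    and "nsq M v = 0" and x: "x \<in> space M"
  shows "v x = 0"
proof -
  obtain D where D: "D > 0" "\<And>x. x \<in> space M \<Longrightarrow> nsq M (kcol M k x) \<le> D"
    using kernel_kcol_bound[OF k] by blast
  have "(cmod (ksq M k v x))\<^sup>2 \<le> 0" using ksq_bound[OF k D(2) v x] assms(5) by simp
  then show ?thesis using ev[OF x] \<open>\<kappa> > 0\<close> by simp
qed

lemma bdd_kernel_diff: "bdd_kernel M k \<Longrightarrow> bdd_kernel M l \<Longrightarrow> bdd_kernel M (\<lambda>x y. k x y - l x y)"
proof -
  assume kl: "bdd_kernel M k" "bdd_kernel M l"
  have [measurable]: "case_prod k \<in> borel_measurable (M \<Otimes>\<^sub>M M)" "case_prod l \<in> borel_measurable (M \<Otimes>\<^sub>M M)"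
    using kl by (simp_all add: bdd_kernel_def)
  obtain C D where C: "\<forall>x\<in>space M. \<forall>y\<in>space M. cmod (k x y) \<le> C"
    "\<forall>x\<in>space M. \<forall>y\<in>space M. cmod (l x y) \<le> D"
    using kl unfolding bdd_kernel_def by blast
  have "\<forall>x\<in>space M. \<forall>y\<in>space M. cmod (k x y - l x y) \<le> C + D"
    using C by (meson add_mono norm_triangle_le_diff)
  moreover have "(\<lambda>(x, y). k x y - l x y) \<in> borel_measurable (M \<Otimes>\<^sub>M M)" by measurable
  ultimately show ?thesis unfolding bdd_kernel_def by blast
qed

lemma bdd_kernel_tensor:
  assumes "bdd_meas M f" "bdd_meas M g" shows "bdd_kernel M (\<lambda>x y. f x * cnj (g y))"
proof -
  have [measurable]: "f \<in> borel_measurable M" "g \<in> borel_measurable M"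
    using assms by (auto intro: bdd_meas_measurable)
  obtain C D where C: "\<forall>x\<in>space M. cmod (f x) \<le> C" "\<forall>x\<in>space M. cmod (g x) \<le> D"
    using assms by (auto simp: bdd_meas_def)
  have "\<forall>x\<in>space M. \<forall>y\<in>space M. cmod (f x * cnj (g y)) \<le> C * D"
    using C by (auto simp: norm_mult intro!: mult_mono intro: order_trans[OF norm_ge_zero])
  moreover have "(\<lambda>(x, y). f x * cnj (g y)) \<in> borel_measurable (M \<Otimes>\<^sub>M M)" by measurable
  ultimately show ?thesis unfolding bdd_kernel_def by blast
qed

lemma bdd_kernel_diff_sum_tensor:
  assumes "bdd_kernel M k" "finite G" "\<And>i. i \<in> G \<Longrightarrow> bdd_meas M (f i)" "\<And>i. i \<in> G \<Longrightarrow> bdd_meas M (g i)"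
  shows "bdd_kernel M (\<lambda>x y. k x y - (\<Sum>i\<in>G. f i x * cnj (g i y)))"
  using assms(2,3,4)
proof (induction G)
  case empty
  then show ?case using assms(1) by simp
next
  case (insert i G)
  then have "bdd_kernel M (\<lambda>x y. (k x y - (\<Sum>i\<in>G. f i x * cnj (g i y))) - f i x * cnj (g i y))"
    by (intro bdd_kernel_diff[OF insert.IH] bdd_kernel_tensor) auto
  then show ?case using insert.hyps by (simp add: algebra_simps)
qed

end

section \<open>Invariant kernels and joint eigenfunctions\<close>

locale measure_preserving = prob_space M for M :: "'a measure" +
  fixes T :: "'a \<Rightarrow> 'a"
  assumes T_meas [measurable]: "T \<in> measurable M M" and T_inv: "distr M M T = M"
begin

lemma T_space: "x \<in> space M \<Longrightarrow> T x \<in> space M"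
  using measurable_space[OF T_meas] .

lemma Tpow_space: "x \<in> space M \<Longrightarrow> (T ^^ n) x \<in> space M"
  by (induction n) (auto intro: T_space)

lemma Tpow_meas [measurable]: "(T ^^ n) \<in> measurable M M"
  by (rule measurable_compose_n) (rule T_meas)

lemma integral_T:
  fixes f :: "'a \<Rightarrow> 'b::{banach, second_countable_topology}"
  assumes "f \<in> borel_measurable M"
  shows "(\<integral>x. f (T x) \<partial>M) = (\<integral>x. f x \<partial>M)"
  using integral_distr[OF T_meas assms] by (simp add: T_inv)

definition inv_kernel :: "('a \<Rightarrow> 'a \<Rightarrow> complex) \<Rightarrow> bool" where
  "inv_kernel k \<longleftrightarrow> bdd_kernel M k \<and> (\<forall>x\<in>space M. \<forall>y\<in>space M. k (T x) (T y) = k x y)"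

lemma inv_kernel_adj: "inv_kernel k \<Longrightarrow> inv_kernel (adj k)"
  unfolding inv_kernel_def by (auto intro: kernel_adj simp: adj_def)

lemma bdd_meas_Tpow: "bdd_meas M f \<Longrightarrow> bdd_meas M (\<lambda>x. f ((T ^^ n) x))"
  unfolding bdd_meas_def using Tpow_space by (auto intro: measurable_compose[OF Tpow_meas])

lemma nsq_T: "bdd_meas M f \<Longrightarrow> nsq M (\<lambda>x. f (T x)) = nsq M f"
  unfolding nsq_def by (rule integral_T[where f = "\<lambda>x. (cmod (f x))\<^sup>2"]) (auto dest: bdd_meas_measurable)

text \<open>Invariance of the measure allows \<open>T y\<close> to be substituted for
  \<open>y\<close> under the integral, and invariance of \<open>k\<close> then removes
  \<open>T\<close> from both arguments. So the operator commutes with composition with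
  \<open>T\<close>.\<close>

lemma kop_T:
  assumes k: "inv_kernel k" and f: "bdd_meas M f" and x: "x \<in> space M"
  shows "kop M k (\<lambda>y. f (T y)) x = kop M k f (T x)"
proof -
  have kk: "bdd_kernel M k" using k by (simp add: inv_kernel_def)
  have "kop M k f (T x) = (\<integral>y. k (T x) (T y) * f (T y) \<partial>M)"
    unfolding kop_def using bdd_meas_mult[OF kernel_row[OF kk T_space[OF x]] f]
    by (intro integral_T[symmetric]) (rule bdd_meas_measurable)
  also have "\<dots> = kop M k (\<lambda>y. f (T y)) x"
    unfolding kop_def using k x by (intro Bochner_Integration.integral_cong) (auto simp: inv_kernel_def)
  finally show ?thesis ..
qed

lemma ksq_T:
  assumes k: "inv_kernel k" and f: "bdd_meas M f" and x: "x \<in> space M"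
  shows "ksq M k (\<lambda>y. f (T y)) x = ksq M k f (T x)"
proof -
  have "ksq M k (\<lambda>y. f (T y)) x = kop M (adj k) (\<lambda>y. kop M k f (T y)) x"
    unfolding ksq_def by (intro kop_cong kop_T k f)
  also have "\<dots> = ksq M k f (T x)" unfolding ksq_def using k
    by (intro kop_T inv_kernel_adj bdd_meas_kop f x) (auto simp: inv_kernel_def)
  finally show ?thesis .
qed

lemma ksq_Tpow:
  assumes k: "inv_kernel k" and f: "bdd_meas M f" and x: "x \<in> space M"
  shows "ksq M k (\<lambda>y. f ((T ^^ n) y)) x = ksq M k f ((T ^^ n) x)"
  using x
proof (induction n arbitrary: x)
  case (Suc n)
  have "ksq M k (\<lambda>y. f ((T ^^ Suc n) y)) x = ksq M k (\<lambda>y. f ((T ^^ n) (T y))) x"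
    by (simp add: funpow_swap1)
  also have "\<dots> = ksq M k (\<lambda>y. f ((T ^^ n) y)) (T x)"
    by (rule ksq_T[OF k bdd_meas_Tpow[OF f] Suc.prems])
  also have "\<dots> = ksq M k f ((T ^^ n) (T x))" by (rule Suc.IH[OF T_space[OF Suc.prems]])
  finally show ?case by (simp add: funpow_swap1)
qed simp

lemma bdd_meas_pact: "bdd_meas M v \<Longrightarrow> bdd_meas M (pact T q v)"
  unfolding pact_def[abs_def] by (intro bdd_meas_sum bdd_meas_cmult bdd_meas_Tpow)

lemma ksq_pact:
  assumes k: "inv_kernel k" and v: "bdd_meas M v"
    and ev: "\<And>x. x \<in> space M \<Longrightarrow> ksq M k v x = c * v x" and x: "x \<in> space M"
  shows "ksq M k (pact T q v) x = c * pact T q v x"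
proof -
  have kk: "bdd_kernel M k" using k by (simp add: inv_kernel_def)
  have "ksq M k (pact T q v) x = (\<Sum>i\<le>degree q. coeff q i * ksq M k (\<lambda>y. v ((T ^^ i) y)) x)"
    unfolding pact_def[abs_def] using v
    by (simp add: ksq_eq_ip kk x bdd_meas_sum bdd_meas_cmult bdd_meas_Tpow ip_sum_left bdd_meas_kcol ip_scale_left)
  also have "\<dots> = c * pact T q v x"
    by (simp add: ksq_Tpow[OF k v x] ev Tpow_space x pact_def sum_distrib_left mult_ac)
  finally show ?thesis .
qed

text \<open>This is finite dimensionality of the eigenspace, seen along the orbit of
  \<open>v\<close>. If no nonzero polynomial annihilated \<open>v\<close> up to null functions,
  Gram-Schmidt on polynomials would yield arbitrarily many orthonormal eigenfunctions
  \<open>pact T q v\<close>. Each of them contributes \<open>\<kappa>\<close> to the sum in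
  \<open>sum_nsq_kop_le\<close>, whose bound does not grow.\<close>

lemma pact_null_exists:
  assumes k: "inv_kernel k" and v: "bdd_meas M v" and \<kappa>: "\<kappa> > 0"
    and ev: "\<And>x. x \<in> space M \<Longrightarrow> ksq M k v x = of_real \<kappa> * v x"
  shows "\<exists>q. q \<noteq> 0 \<and> nsq M (pact T q v) = 0"
proof (rule ccontr)
  assume "\<not> ?thesis"
  then have pos: "nsq M (pact T q v) > 0" if "q \<noteq> 0" for q
    using nsq_nonneg[of M "pact T q v"] that by (metis less_eq_real_def)
  have kk: "bdd_kernel M k" using k by (simp add: inv_kernel_def)
  have pb: "\<And>q. bdd_meas M (pact T q v)" by (intro bdd_meas_pact v)
  have ex: "\<exists>Q. finite Q \<and> card Q = m \<and> orthonormal M (\<lambda>q. pact T q v) Q" for m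
  proof (induction m)
    case 0
    then show ?case by (intro exI[of _ "{}"]) (simp add: orthonormal_def)
  next
    case (Suc m)
    then obtain Q where Q: "finite Q" "card Q = m" "orthonormal M (\<lambda>q. pact T q v) Q" by blast
    \<comment> \<open>Above the degree of every member of \<open>Q\<close>, so that
      \<open>r0\<close> keeps the coefficient 1 at \<open>d\<close> and is not the zero
      polynomial.\<close>
    define d where "d = Suc (\<Sum>q\<in>Q. degree q)"
    have d: "degree q < d" if "q \<in> Q" for q
      using member_le_sum[of q Q degree] that Q(1) by (simp add: d_def)
    define w where "w = pact T (monom 1 d) v"
    define r0 where "r0 = monom 1 d - (\<Sum>q\<in>Q. smult (ip M w (pact T q v)) q)"
    have "coeff r0 d = 1"
      by (simp add: r0_def coeff_sum coeff_eq_0 d)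
    then have "r0 \<noteq> 0" by auto
    have r0_eq: "pact T r0 v = (\<lambda>x. w x - (\<Sum>q\<in>Q. ip M w (pact T q v) * pact T q v x))"
      by (simp add: r0_def pact_diff pact_sum pact_smult w_def fun_eq_iff)
    have w: "bdd_meas M w" by (simp add: w_def pb)
    have orth0: "ip M (pact T r0 v) (pact T q v) = 0" if q: "q \<in> Q" for q
    proof -
      have "ip M (pact T r0 v) (pact T q v)
          = ip M w (pact T q v) - (\<Sum>p\<in>Q. ip M w (pact T p v) * ip M (pact T p v) (pact T q v))"
        unfolding r0_eq by (simp add: ip_diff_left ip_sum_left ip_scale_left bdd_meas_sum bdd_meas_cmult pb w)
      also have "(\<Sum>p\<in>Q. ip M w (pact T p v) * ip M (pact T p v) (pact T q v))
          = (\<Sum>p\<in>Q. if p = q then ip M w (pact T q v) else 0)"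
        using Q(3) q by (intro sum.cong) (auto simp: orthonormal_def)
      finally show ?thesis using q Q(1) by simp
    qed
    define c where "c = complex_of_real (1 / sqrt (nsq M (pact T r0 v)))"
    define r where "r = smult c r0"
    have r_eq: "pact T r v = (\<lambda>x. c * pact T r0 v x)" by (simp add: r_def pact_smult fun_eq_iff)
    have "nsq M (pact T r v) = 1"
      unfolding r_eq nsq_scale using pos[OF \<open>r0 \<noteq> 0\<close>] by (simp add: c_def norm_divide power_divide)
    then have rr: "ip M (pact T r v) (pact T r v) = 1" by (simp add: ip_self)
    have rq: "ip M (pact T r v) (pact T q v) = 0" if "q \<in> Q" for q
      unfolding r_eq ip_scale_left using orth0[OF that] by simp
    then have qr: "ip M (pact T q v) (pact T r v) = 0" if "q \<in> Q" for q
      using that by (subst ip_cnj) simp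
    have "r \<notin> Q" using rr rq by force
    moreover have "orthonormal M (\<lambda>q. pact T q v) (insert r Q)"
      using Q(3) rr rq qr \<open>r \<notin> Q\<close> by (auto simp: orthonormal_def pb)
    ultimately show ?case using Q by (intro exI[of _ "insert r Q"]) auto
  qed
  obtain C where C: "\<And>x y. x \<in> space M \<Longrightarrow> y \<in> space M \<Longrightarrow> cmod (k x y) \<le> C"
    using kk unfolding bdd_kernel_def by metis
  obtain m :: nat where m: "C\<^sup>2 / \<kappa> < m" using reals_Archimedean2 by blast
  obtain Q where Q: "finite Q" "card Q = m" "orthonormal M (\<lambda>q. pact T q v) Q" using ex by blast
  have "nsq M (kop M k (pact T q v)) = \<kappa>" if "q \<in> Q" for q
  proof -
    have "complex_of_real (nsq M (pact T q v)) = 1" using Q(3) that by (simp add: orthonormal_def flip: ip_self)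
    then have "nsq M (pact T q v) = 1" by simp
    then show ?thesis using nsq_kop_eigenfunction[OF kk pb ksq_pact[OF k v ev]] by simp
  qed
  then have "(\<Sum>q\<in>Q. nsq M (kop M k (pact T q v))) = m * \<kappa>" using Q(2) by simp
  moreover have "(\<Sum>q\<in>Q. nsq M (kop M k (pact T q v))) \<le> C\<^sup>2"
    by (rule sum_nsq_kop_le[OF kk C Q(3,1)])
  ultimately show False using m \<kappa> by (simp add: field_simps)
qed

text \<open>Split a root \<open>z\<close> off \<open>q\<close>, leaving the cofactor
  \<open>p\<close>. Either \<open>p\<close> annihilates \<open>v\<close> as well and has smaller
  degree, or \<open>w = pact T p v\<close> is not null and \<open>q\<close> annihilating
  \<open>v\<close> says that \<open>w (T x) = z * w x\<close>. In degree 0 a nonzero constant would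
  annihilate \<open>v\<close>.\<close>

lemma joint_eigenfunction_of_null_poly:
  assumes k: "inv_kernel k" and \<kappa>: "\<kappa> > 0" and v: "bdd_meas M v" "nsq M v > 0"
    and ev: "\<And>x. x \<in> space M \<Longrightarrow> ksq M k v x = of_real \<kappa> * v x"
  shows "q \<noteq> 0 \<Longrightarrow> (\<And>x. x \<in> space M \<Longrightarrow> pact T q v x = 0) \<Longrightarrow>
    \<exists>w z. bdd_meas M w \<and> nsq M w > 0 \<and> (\<forall>x\<in>space M. ksq M k w x = of_real \<kappa> * w x)
      \<and> (\<forall>x\<in>space M. w (T x) = z * w x)"
proof (induction "degree q" arbitrary: q)
  case 0
  then obtain c where "q = [:c:]" "c \<noteq> 0" by (metis degree_eq_zeroE pCons_0_0)
  then have "v x = 0" if "x \<in> space M" for x using 0(3)[OF that] by (simp add: pact_def)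
  then have "nsq M v = nsq M (\<lambda>x. 0)" by (intro nsq_cong)
  then show ?case using v(2) by (simp add: nsq_def)
next
  case (Suc n)
  have "\<not> constant (poly q)" using Suc(2) by (simp add: constant_degree)
  then obtain z where "poly q z = 0" using fundamental_theorem_of_algebra by blast
  then obtain p where p: "q = [:- z, 1:] * p" by (auto simp: poly_eq_0_iff_dvd dvd_def)
  then have "p \<noteq> 0" using Suc(3) by auto
  then have deg: "degree p = n" using Suc(2) unfolding p by (subst (asm) degree_mult_eq) auto
  define w where "w = pact T p v"
  have w: "bdd_meas M w" "\<And>x. x \<in> space M \<Longrightarrow> ksq M k w x = of_real \<kappa> * w x"
    unfolding w_def by (auto intro: bdd_meas_pact v ksq_pact[OF k v(1) ev])
  show ?case
  proof (cases "nsq M w = 0")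
    case True
    then have "\<And>x. x \<in> space M \<Longrightarrow> pact T p v x = 0"
      using ksq_eigenfunction_eq_0[OF _ w(1) \<kappa> w(2)] k by (auto simp: inv_kernel_def w_def)
    then show ?thesis using Suc(1)[of p] deg \<open>p \<noteq> 0\<close> by simp
  next
    case False
    then have "nsq M w > 0" using nsq_nonneg[of M w] by linarith
    moreover have "w (T x) = z * w x" if "x \<in> space M" for x
      using Suc(4)[OF that] unfolding p pact_linear_factor w_def by simp
    ultimately show ?thesis using w by blast
  qed
qed

lemma joint_eigenfunction_exists:
  assumes k: "inv_kernel k"
  obtains \<kappa> where "\<kappa> \<ge> 0" "\<And>f. bdd_meas M f \<Longrightarrow> nsq M (kop M k f) \<le> \<kappa> * nsq M f"
    "\<kappa> > 0 \<Longrightarrow> \<exists>w z. bdd_meas M w \<and> nsq M w = 1 \<and> (\<forall>x\<in>space M. ksq M k w x = of_real \<kappa> * w x)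
      \<and> (\<forall>x\<in>space M. w (T x) = z * w x)"
proof -
  have kk: "bdd_kernel M k" using k by (simp add: inv_kernel_def)
  obtain \<kappa> where \<kappa>: "\<kappa> \<ge> 0" "\<And>f. bdd_meas M f \<Longrightarrow> nsq M (kop M k f) \<le> \<kappa> * nsq M f"
    "\<kappa> > 0 \<Longrightarrow> \<exists>v. bdd_meas M v \<and> nsq M v > 0 \<and> (\<forall>x\<in>space M. ksq M k v x = of_real \<kappa> * v x)"
    using ksq_eigenfunction_exists[OF kk] by blast
  have "\<exists>w z. bdd_meas M w \<and> nsq M w = 1 \<and> (\<forall>x\<in>space M. ksq M k w x = of_real \<kappa> * w x)
      \<and> (\<forall>x\<in>space M. w (T x) = z * w x)" if pos: "\<kappa> > 0"
  proof -
    obtain v where v: "bdd_meas M v" "nsq M v > 0" "\<And>x. x \<in> space M \<Longrightarrow> ksq M k v x = of_real \<kappa> * v x"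
      using \<kappa>(3)[OF pos] by blast
    obtain q where q: "q \<noteq> 0" "nsq M (pact T q v) = 0"
      using pact_null_exists[OF k v(1) pos v(3)] by blast
    have "pact T q v x = 0" if "x \<in> space M" for x
      using ksq_eigenfunction_eq_0[OF kk bdd_meas_pact[OF v(1)] pos ksq_pact[OF k v(1) v(3)] q(2) that] by simp
    then obtain w z where w: "bdd_meas M w" "nsq M w > 0"
      "\<forall>x\<in>space M. ksq M k w x = of_real \<kappa> * w x" "\<forall>x\<in>space M. w (T x) = z * w x"
      using joint_eigenfunction_of_null_poly[OF k pos v q(1)] by blast
    define c where "c = complex_of_real (1 / sqrt (nsq M w))"
    have "nsq M (\<lambda>x. c * w x) = 1"
      unfolding nsq_scale using w(2) by (simp add: c_def norm_divide power_divide)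
    moreover have "bdd_meas M (\<lambda>x. c * w x)" by (intro bdd_meas_cmult w)
    moreover have "\<forall>x\<in>space M. ksq M k (\<lambda>x. c * w x) x = of_real \<kappa> * (c * w x)"
      using w(3) by (simp add: ksq_scale)
    moreover have "\<forall>x\<in>space M. c * w (T x) = z * (c * w x)" using w(4) by simp
    ultimately show ?thesis by blast
  qed
  then show ?thesis using that \<kappa>(1,2) by blast
qed

end

section \<open>The closed span of the eigenfunctions\<close>

text \<open>Square integrability is part of the notion because a nonintegrable square has integral
  0: for a measurable \<open>f\<close> outside L2 the estimate would hold trivially.\<close>

definition spectral_approx :: "'a measure \<Rightarrow> ('a \<Rightarrow> 'a) \<Rightarrow> ('a \<Rightarrow> complex) \<Rightarrow> bool" where
  "spectral_approx M T f \<longleftrightarrow> square_integrable M f \<and>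
     (\<forall>e>0. \<exists>G c. finite G \<and> (\<forall>g\<in>G. eigenfunction M T g) \<and>
        (\<integral>x. (cmod (f x - (\<Sum>g\<in>G. c g * g x)))\<^sup>2 \<partial>M) < e)"

lemma cmod_add_sq_le: "(cmod (a + b))\<^sup>2 \<le> 2 * (cmod a)\<^sup>2 + 2 * (cmod b)\<^sup>2"
proof -
  have "(cmod (a + b))\<^sup>2 \<le> (cmod a + cmod b)\<^sup>2" by (intro power_mono norm_triangle_ineq) auto
  also have "\<dots> = 2 * (cmod a)\<^sup>2 + 2 * (cmod b)\<^sup>2 - (cmod a - cmod b)\<^sup>2"
    by (simp add: power2_eq_square algebra_simps)
  finally show ?thesis by (smt (verit) zero_le_power2)
qed

lemma square_integrable_add:
  assumes "square_integrable M f" "square_integrable M g"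
  shows "square_integrable M (\<lambda>x. f x + g x)"
proof -
  have [measurable]: "f \<in> borel_measurable M" "g \<in> borel_measurable M"
    using assms by (auto simp: square_integrable_def)
  have int: "integrable M (\<lambda>x. 2 * (cmod (f x))\<^sup>2 + 2 * (cmod (g x))\<^sup>2)"
    using assms by (auto simp: square_integrable_def)
  have "integrable M (\<lambda>x. (cmod (f x + g x))\<^sup>2)"
    by (rule Bochner_Integration.integrable_bound[OF int]) (auto intro: cmod_add_sq_le)
  then show ?thesis by (simp add: square_integrable_def)
qed

lemma square_integrable_cmult:
  "square_integrable M f \<Longrightarrow> square_integrable M (\<lambda>x. c * f x)"
  by (auto simp: square_integrable_def norm_mult power_mult_distrib)

lemma square_integrable_diff:
  "square_integrable M f \<Longrightarrow> square_integrable M g \<Longrightarrow> square_integrable M (\<lambda>x. f x - g x)"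
  using square_integrable_add[of M f "\<lambda>x. - 1 * g x"] square_integrable_cmult[of M g "- 1"] by simp

lemma square_integrable_0: "square_integrable M (\<lambda>x. 0)"
  by (simp add: square_integrable_def)

lemma square_integrable_sum:
  "(\<And>i. i \<in> I \<Longrightarrow> square_integrable M (f i)) \<Longrightarrow> square_integrable M (\<lambda>x. \<Sum>i\<in>I. f i x)"
  by (induction I rule: infinite_finite_induct)
    (auto intro: square_integrable_add square_integrable_0)

lemma eigenfunction_square_integrable: "eigenfunction M T g \<Longrightarrow> square_integrable M g"
  by (simp add: eigenfunction_def)

lemma nsq_add_le:
  assumes "square_integrable M f" "square_integrable M g"
  shows "nsq M (\<lambda>x. f x + g x) \<le> 2 * nsq M f + 2 * nsq M g"
proof -
  have int: "integrable M (\<lambda>x. 2 * (cmod (f x))\<^sup>2 + 2 * (cmod (g x))\<^sup>2)"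
    using assms by (auto simp: square_integrable_def)
  have "nsq M (\<lambda>x. f x + g x) \<le> (\<integral>x. 2 * (cmod (f x))\<^sup>2 + 2 * (cmod (g x))\<^sup>2 \<partial>M)"
    unfolding nsq_def using square_integrable_add[OF assms] int cmod_add_sq_le
    by (intro integral_mono) (auto simp: square_integrable_def)
  also have "\<dots> = 2 * nsq M f + 2 * nsq M g"
    unfolding nsq_def using assms by (subst Bochner_Integration.integral_add) (auto simp: square_integrable_def)
  finally show ?thesis .
qed

text \<open>The coefficients are indexed by functions, so sums over two finite sets of eigenfunctions are
  merged by extending both coefficient functions by zero.\<close>
lemma eigenfunction_sum_add:
  assumes "finite G" "finite H"
  obtains c where "\<And>x. (\<Sum>g\<in>G. a g * g x) + (\<Sum>g\<in>H. b g * g x) = (\<Sum>g\<in>G \<union> H. c g * (g x :: complex))"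
proof -
  define c where "c g = (if g \<in> G then a g else 0) + (if g \<in> H then b g else 0)" for g
  have "(\<Sum>g\<in>G \<union> H. c g * g x) = (\<Sum>g\<in>G. a g * g x) + (\<Sum>g\<in>H. b g * g x)" for x
  proof -
    have "(\<Sum>g\<in>G \<union> H. c g * g x)
        = (\<Sum>g\<in>G \<union> H. if g \<in> G then a g * g x else 0) + (\<Sum>g\<in>G \<union> H. if g \<in> H then b g * g x else 0)"
      unfolding sum.distrib[symmetric] by (intro sum.cong) (auto simp: c_def distrib_right)
    also have "\<dots> = (\<Sum>g\<in>G. a g * g x) + (\<Sum>g\<in>H. b g * g x)"
      using assms by (simp flip: sum.inter_restrict add: Int_absorb1)
    finally show ?thesis .
  qed
  then show ?thesis using that[of c] by simp
qed

lemma spectral_approxE: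
  assumes "spectral_approx M T f" "e > 0"
  obtains G c where "finite G" "\<forall>g\<in>G. eigenfunction M T g" "nsq M (\<lambda>x. f x - (\<Sum>g\<in>G. c g * g x)) < e"
proof -
  have "\<exists>G c. finite G \<and> (\<forall>g\<in>G. eigenfunction M T g) \<and> nsq M (\<lambda>x. f x - (\<Sum>g\<in>G. c g * g x)) < e"
    using assms unfolding spectral_approx_def nsq_def by simp
  then show ?thesis using that by (elim exE conjE)
qed

lemma spectral_approx_limit:
  assumes f: "square_integrable M f"
    and lim: "\<And>e. e > 0 \<Longrightarrow> \<exists>g. spectral_approx M T g \<and> nsq M (\<lambda>x. f x - g x) < e"
  shows "spectral_approx M T f"
  unfolding spectral_approx_def
proof (intro conjI f allI impI)
  fix e :: real assume e: "e > 0"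
  \<comment> \<open>Squared norms are subadditive only up to the factor 2
    (\<open>nsq_add_le\<close>), hence two errors of \<open>e / 4\<close>.\<close>
  obtain g where g: "spectral_approx M T g" "nsq M (\<lambda>x. f x - g x) < e / 4" using lim[of "e / 4"] e by auto
  obtain G c where G: "finite G" "\<forall>g\<in>G. eigenfunction M T g"
      "nsq M (\<lambda>x. g x - (\<Sum>g\<in>G. c g * g x)) < e / 4"
    using spectral_approxE[OF g(1), of "e / 4"] e by auto
  have sg: "square_integrable M g" using g(1) by (simp add: spectral_approx_def)
  have sG: "square_integrable M (\<lambda>x. \<Sum>g\<in>G. c g * g x)"
    using G(2) by (intro square_integrable_sum square_integrable_cmult eigenfunction_square_integrable) auto
  have "nsq M (\<lambda>x. (f x - g x) + (g x - (\<Sum>g\<in>G. c g * g x)))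
      \<le> 2 * nsq M (\<lambda>x. f x - g x) + 2 * nsq M (\<lambda>x. g x - (\<Sum>g\<in>G. c g * g x))"
    by (intro nsq_add_le square_integrable_diff f sg sG)
  then have "nsq M (\<lambda>x. f x - (\<Sum>g\<in>G. c g * g x)) < e" using g(2) G(3) by simp
  then show "\<exists>G c. finite G \<and> (\<forall>g\<in>G. eigenfunction M T g) \<and>
      (\<integral>x. (cmod (f x - (\<Sum>g\<in>G. c g * g x)))\<^sup>2 \<partial>M) < e"
    using G unfolding nsq_def by blast
qed

lemma spectral_approx_add:
  assumes "spectral_approx M T f" "spectral_approx M T g"
  shows "spectral_approx M T (\<lambda>x. f x + g x)"
  unfolding spectral_approx_def
proof (intro conjI allI impI)
  have s: "square_integrable M f" "square_integrable M g"
    using assms by (auto simp: spectral_approx_def)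
  then show "square_integrable M (\<lambda>x. f x + g x)" by (rule square_integrable_add)
  fix e :: real assume e: "e > 0"
  then have e4: "e / 4 > 0" by simp
  obtain F a where F: "finite F" "\<forall>g\<in>F. eigenfunction M T g" "nsq M (\<lambda>x. f x - (\<Sum>g\<in>F. a g * g x)) < e / 4"
    by (rule spectral_approxE[OF assms(1) e4])
  obtain G b where G: "finite G" "\<forall>g\<in>G. eigenfunction M T g" "nsq M (\<lambda>x. g x - (\<Sum>g\<in>G. b g * g x)) < e / 4"
    by (rule spectral_approxE[OF assms(2) e4])
  obtain c where c: "\<And>x. (\<Sum>g\<in>F. a g * g x) + (\<Sum>g\<in>G. b g * g x) = (\<Sum>g\<in>F \<union> G. c g * g x)"
    using eigenfunction_sum_add[OF F(1) G(1), of a b] by blast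
  have "nsq M (\<lambda>x. (f x - (\<Sum>g\<in>F. a g * g x)) + (g x - (\<Sum>g\<in>G. b g * g x)))
      \<le> 2 * nsq M (\<lambda>x. f x - (\<Sum>g\<in>F. a g * g x)) + 2 * nsq M (\<lambda>x. g x - (\<Sum>g\<in>G. b g * g x))"
    using F(2) G(2) by (intro nsq_add_le square_integrable_diff s square_integrable_sum
      square_integrable_cmult eigenfunction_square_integrable) auto
  also have "(\<lambda>x. (f x - (\<Sum>g\<in>F. a g * g x)) + (g x - (\<Sum>g\<in>G. b g * g x)))
      = (\<lambda>x. f x + g x - (\<Sum>g\<in>F \<union> G. c g * g x))"
    unfolding c[symmetric] by (simp add: fun_eq_iff)
  finally have "nsq M (\<lambda>x. f x + g x - (\<Sum>g\<in>F \<union> G. c g * g x)) < e" using F(3) G(3) by simp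
  then show "\<exists>G c. finite G \<and> (\<forall>g\<in>G. eigenfunction M T g) \<and>
      (\<integral>x. (cmod (f x + g x - (\<Sum>g\<in>G. c g * g x)))\<^sup>2 \<partial>M) < e"
    using F G unfolding nsq_def by (intro exI[of _ "F \<union> G"] exI[of _ c]) auto
qed

lemma spectral_approx_eigenfunction:
  assumes "eigenfunction M T g" shows "spectral_approx M T g"
  unfolding spectral_approx_def using assms
  by (auto simp: eigenfunction_square_integrable intro!: exI[of _ "{g}"] exI[of _ "\<lambda>_. 1"])

text \<open>The empty sum serves here, as a null function is no eigenfunction.\<close>

lemma spectral_approx_null:
  assumes "f \<in> borel_measurable M" "AE x in M. f x = 0" shows "spectral_approx M T f"
proof -
  have z: "AE x in M. (cmod (f x))\<^sup>2 = 0" using assms(2) by auto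
  have "integrable M (\<lambda>x. (cmod (f x))\<^sup>2)"
    using integrable_cong_AE[of "\<lambda>x. (cmod (f x))\<^sup>2" M "\<lambda>x. 0"] z assms(1) by auto
  moreover have "(\<integral>x. (cmod (f x))\<^sup>2 \<partial>M) = 0" using z by (rule integral_eq_zero_AE)
  ultimately show ?thesis unfolding spectral_approx_def square_integrable_def using assms(1)
    by (auto intro!: exI[of _ "{}"])
qed

lemma spectral_approx_cmult:
  assumes "spectral_approx M T f"
  shows "spectral_approx M T (\<lambda>x. a * f x)"
proof (cases "a = 0")
  case True
  then show ?thesis by (auto intro: spectral_approx_null)
next
  case False
  show ?thesis unfolding spectral_approx_def
  proof (intro conjI allI impI)
    show "square_integrable M (\<lambda>x. a * f x)"
      using assms by (simp add: spectral_approx_def square_integrable_cmult)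
    fix e :: real assume e: "e > 0"
    then have "e / (cmod a)\<^sup>2 > 0" using False by simp
    then obtain G c where G: "finite G" "\<forall>g\<in>G. eigenfunction M T g"
        "nsq M (\<lambda>x. f x - (\<Sum>g\<in>G. c g * g x)) < e / (cmod a)\<^sup>2"
      using spectral_approxE[OF assms] by auto
    have "nsq M (\<lambda>x. a * f x - (\<Sum>g\<in>G. (a * c g) * g x))
        = nsq M (\<lambda>x. a * (f x - (\<Sum>g\<in>G. c g * g x)))"
      by (simp add: sum_distrib_left right_diff_distrib mult.assoc)
    also have "\<dots> < e" unfolding nsq_scale using G(3) False by (simp add: field_simps)
    finally show "\<exists>G c. finite G \<and> (\<forall>g\<in>G. eigenfunction M T g) \<and>
        (\<integral>x. (cmod (a * f x - (\<Sum>g\<in>G. c g * g x)))\<^sup>2 \<partial>M) < e"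
      using G unfolding nsq_def by (intro exI[of _ G] exI[of _ "\<lambda>g. a * c g"]) auto
  qed
qed

lemma spectral_approx_sum:
  "(\<And>i. i \<in> I \<Longrightarrow> spectral_approx M T (f i)) \<Longrightarrow> spectral_approx M T (\<lambda>x. \<Sum>i\<in>I. f i x)"
  by (induction I rule: infinite_finite_induct) (auto intro: spectral_approx_add spectral_approx_null)

section \<open>The range of an invariant kernel\<close>

context measure_preserving
begin

text \<open>Unlike an eigenfunction, such a function may be null, so the class is stable under
  operators with invariant kernels (\<open>bdd_eigen_kop\<close>).\<close>

definition bdd_eigen :: "('a \<Rightarrow> complex) \<Rightarrow> bool" where
  "bdd_eigen w \<longleftrightarrow> bdd_meas M w \<and> (\<exists>z. \<forall>x\<in>space M. w (T x) = z * w x)"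

lemma bdd_eigen_spectral_approx:
  assumes "bdd_eigen w" shows "spectral_approx M T w"
proof (cases "AE x in M. w x = 0")
  case True
  then show ?thesis using assms by (intro spectral_approx_null) (auto simp: bdd_eigen_def bdd_meas_measurable)
next
  case False
  then have "eigenfunction M T w" using assms
    unfolding bdd_eigen_def eigenfunction_def by (auto intro: bdd_meas_square_integrable)
  then show ?thesis by (rule spectral_approx_eigenfunction)
qed

lemma bdd_eigen_kop:
  assumes k: "inv_kernel k" and w: "bdd_eigen w"
  shows "bdd_eigen (kop M k w)"
proof -
  have kk: "bdd_kernel M k" using k by (simp add: inv_kernel_def)
  obtain z where z: "\<And>x. x \<in> space M \<Longrightarrow> w (T x) = z * w x" and b: "bdd_meas M w"
    using w by (auto simp: bdd_eigen_def)
  have "kop M k w (T x) = z * kop M k w x" if x: "x \<in> space M" for x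
    using kop_T[OF k b x] kop_cong[of M "\<lambda>y. w (T y)" "\<lambda>y. z * w y" k x] z by (simp add: kop_scale)
  then show ?thesis using bdd_meas_kop[OF kk b] by (auto simp: bdd_eigen_def)
qed

text \<open>Composition with \<open>T\<close> preserves the norm. Eigenvalues of modulus 1 are what
  makes the kernel \<open>kop M k w x * cnj (w y)\<close> invariant, so that subtracting it from an
  invariant kernel leaves an invariant one.\<close>

lemma unit_eigenvalue:
  assumes w: "bdd_meas M w" "nsq M w = 1" and z: "\<And>x. x \<in> space M \<Longrightarrow> w (T x) = z * w x"
  shows "z * cnj z = 1"
proof -
  have "1 = nsq M (\<lambda>x. w (T x))" using nsq_T[OF w(1)] w(2) by simp
  also have "\<dots> = nsq M (\<lambda>x. z * w x)" by (intro nsq_cong z)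
  also have "\<dots> = (cmod z)\<^sup>2" unfolding nsq_scale w(2) by simp
  finally show ?thesis by (simp flip: complex_norm_square del: of_real_power)
qed

text \<open>\<open>G\<close> almost maximises the sum of \<open>nsq M (kop M k w)\<close> over orthonormal sets of eigenfunctions. If the
  residual kernel \<open>h\<close> had norm above \<open>e\<close>, a joint eigenfunction of \<open>h\<close> could be added to \<open>G\<close>.\<close>
lemma kop_eigen_expansion:
  assumes k: "inv_kernel k" and e: "e > 0"
  obtains G where "finite G" "\<And>w. w \<in> G \<Longrightarrow> bdd_eigen w"
    "\<And>f. bdd_meas M f \<Longrightarrow> nsq M (\<lambda>x. kop M k f x - (\<Sum>w\<in>G. ip M f w * kop M k w x)) \<le> e * nsq M f"
proof -
  have kk: "bdd_kernel M k" using k by (simp add: inv_kernel_def)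
  obtain C where C: "\<And>x y. x \<in> space M \<Longrightarrow> y \<in> space M \<Longrightarrow> cmod (k x y) \<le> C"
    using kk unfolding bdd_kernel_def by metis
  define good where "good G \<longleftrightarrow> finite G \<and> orthonormal M (\<lambda>w. w) G \<and> (\<forall>w\<in>G. bdd_eigen w)" for G
  define hs where "hs G = (\<Sum>w\<in>G. nsq M (kop M k w))" for G
  have bdd: "bdd_above (hs ` Collect good)"
    unfolding hs_def good_def by (rule bdd_aboveI[of _ "C\<^sup>2"]) (use sum_nsq_kop_le[OF kk C] in auto)
  have "good {}" by (simp add: good_def orthonormal_def)
  then have ne: "hs ` Collect good \<noteq> {}" by auto
  obtain G where G: "good G" "Sup (hs ` Collect good) - e < hs G"
    using less_cSupD[OF ne, of "Sup (hs ` Collect good) - e"] e by auto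
  have fin: "finite G" and on: "orthonormal M (\<lambda>w. w) G" and eig: "\<And>w. w \<in> G \<Longrightarrow> bdd_eigen w"
    using G(1) by (auto simp: good_def)
  have wb: "\<And>w. w \<in> G \<Longrightarrow> bdd_meas M w" using on by (auto simp: orthonormal_def)
  have wo: "\<And>v w. v \<in> G \<Longrightarrow> w \<in> G \<Longrightarrow> ip M v w = (if v = w then 1 else 0)"
    using on by (auto simp: orthonormal_def)
  have Kb: "\<And>w. w \<in> G \<Longrightarrow> bdd_meas M (kop M k w)" by (intro bdd_meas_kop kk wb)
  \<comment> \<open>The kernel of \<open>K\<close> preceded by the projection onto the orthogonal
    complement of \<open>G\<close>.\<close>
  define h where "h x y = k x y - (\<Sum>w\<in>G. kop M k w x * cnj (w y))" for x y
  have h: "inv_kernel h" unfolding inv_kernel_def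
  proof (intro conjI ballI)
    show hk: "bdd_kernel M h" unfolding h_def
      by (intro bdd_kernel_diff_sum_tensor kk fin wb Kb)
    fix x y assume xy: "x \<in> space M" "y \<in> space M"
    have "kop M k w (T x) * cnj (w (T y)) = kop M k w x * cnj (w y)" if w: "w \<in> G" for w
    proof -
      obtain z where z: "\<And>x. x \<in> space M \<Longrightarrow> w (T x) = z * w x"
        using eig[OF w] by (auto simp: bdd_eigen_def)
      have "complex_of_real (nsq M w) = 1" using wo[OF w w] by (simp add: ip_self)
      then have "z * cnj z = 1" by (intro unit_eigenvalue[OF wb[OF w] _ z]) simp_all
      moreover have "kop M k w (T x) = z * kop M k w x"
        using kop_T[OF k wb[OF w] xy(1)] kop_cong[of M "\<lambda>y. w (T y)" "\<lambda>y. z * w y" k x] z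
        by (simp add: kop_scale)
      ultimately show ?thesis using z[OF xy(2)] by (simp add: algebra_simps)
    qed
    then show "h (T x) (T y) = h x y" using k xy by (simp add: h_def inv_kernel_def)
  qed
  then have hk: "bdd_kernel M h" by (simp add: inv_kernel_def)
  have h_eq: "kop M h f x = kop M k f x - (\<Sum>w\<in>G. ip M f w * kop M k w x)"
    if f: "bdd_meas M f" and x: "x \<in> space M" for f x
  proof -
    have "kop M h f x = (\<integral>y. k x y * f y - (\<Sum>w\<in>G. kop M k w x * (f y * cnj (w y))) \<partial>M)"
      unfolding kop_def[of M h f x] h_def
      by (intro Bochner_Integration.integral_cong refl) (simp add: left_diff_distrib right_diff_distrib sum_distrib_left sum_distrib_right mult_ac)
    also have "\<dots> = kop M k f x - (\<Sum>w\<in>G. kop M k w x * ip M f w)"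
      unfolding ip_def kop_def[of M k f x]
      using bdd_meas_integrable[OF bdd_meas_mult[OF kernel_row[OF kk x] f]]
        bdd_meas_integrable[OF bdd_meas_mult[OF f bdd_meas_cnj[OF wb]]]
      by (subst Bochner_Integration.integral_diff) (auto simp: Bochner_Integration.integral_sum)
    finally show ?thesis by (simp add: mult.commute)
  qed
  obtain \<kappa> where \<kappa>: "\<kappa> \<ge> 0" "\<And>f. bdd_meas M f \<Longrightarrow> nsq M (kop M h f) \<le> \<kappa> * nsq M f"
    "\<kappa> > 0 \<Longrightarrow> \<exists>w z. bdd_meas M w \<and> nsq M w = 1 \<and> (\<forall>x\<in>space M. ksq M h w x = of_real \<kappa> * w x)
      \<and> (\<forall>x\<in>space M. w (T x) = z * w x)"
    using joint_eigenfunction_exists[OF h] by blast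
  have "\<kappa> \<le> e"
  proof (rule ccontr)
    assume "\<not> \<kappa> \<le> e"
    then have pos: "\<kappa> > 0" using e by simp
    obtain v z where v: "bdd_meas M v" "nsq M v = 1" "\<And>x. x \<in> space M \<Longrightarrow> ksq M h v x = of_real \<kappa> * v x"
        "\<And>x. x \<in> space M \<Longrightarrow> v (T x) = z * v x"
      using \<kappa>(3)[OF pos] by blast
    \<comment> \<open>The operator of \<open>h\<close> kills \<open>G\<close>, and \<open>v\<close>
      is a multiple of an image under its selfadjoint square \<open>ksq M h\<close>.\<close>
    have orth: "ip M v w = 0" if w: "w \<in> G" for w
    proof -
      have "kop M h w x = 0" if x: "x \<in> space M" for x
      proof -
        have "(\<Sum>u\<in>G. ip M w u * kop M k u x) = (\<Sum>u\<in>G. if u = w then kop M k u x else 0)"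
          using w by (intro sum.cong) (auto simp: wo)
        then show ?thesis using h_eq[OF wb[OF w] x] w fin by simp
      qed
      then have "ip M (kop M h v) (kop M h w) = ip M (kop M h v) (\<lambda>x. 0)" by (intro ip_cong) auto
      then have "ip M (ksq M h v) w = 0"
        using ksq_ip_kop[OF hk v(1) wb[OF w]] by (simp add: ip_def)
      moreover have "ip M (ksq M h v) w = \<kappa> * ip M v w"
        unfolding ip_scale_left[symmetric] by (intro ip_cong v(3)) auto
      ultimately show ?thesis using pos by simp
    qed
    then have orth': "ip M w v = 0" if "w \<in> G" for w using that by (subst ip_cnj) simp
    have vv: "ip M v v = 1" using v(2) by (simp add: ip_self)
    have "v \<notin> G" using orth vv by force
    have "good (insert v G)"
      unfolding good_def using fin on eig v(1,4) orth orth' vv \<open>v \<notin> G\<close>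
      by (auto simp: orthonormal_def bdd_eigen_def)
    then have "hs (insert v G) \<le> Sup (hs ` Collect good)" by (intro cSup_upper bdd) auto
    moreover have "hs (insert v G) = nsq M (kop M k v) + hs G"
      using fin \<open>v \<notin> G\<close> by (simp add: hs_def)
    \<comment> \<open>On the complement of \<open>G\<close> the kernels \<open>h\<close> and
      \<open>k\<close> act alike. So adding \<open>v\<close> to \<open>G\<close> would raise
      \<open>hs\<close> by \<open>\<kappa> > e\<close>, past the supremum.\<close>
    moreover have "nsq M (kop M k v) = \<kappa>"
    proof -
      have "nsq M (kop M k v) = nsq M (kop M h v)"
        by (intro nsq_cong) (simp add: h_eq v(1) orth)
      also have "\<dots> = \<kappa>" using nsq_kop_eigenfunction[OF hk v(1) v(3)] v(2) by simp
      finally show ?thesis .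
    qed
    ultimately show False using G(2) \<open>\<not> \<kappa> \<le> e\<close> by simp
  qed
  have "nsq M (\<lambda>x. kop M k f x - (\<Sum>w\<in>G. ip M f w * kop M k w x)) \<le> e * nsq M f" if f: "bdd_meas M f" for f
  proof -
    have "nsq M (\<lambda>x. kop M k f x - (\<Sum>w\<in>G. ip M f w * kop M k w x)) = nsq M (kop M h f)"
      by (intro nsq_cong) (simp add: h_eq f)
    also have "\<dots> \<le> \<kappa> * nsq M f" by (rule \<kappa>(2)[OF f])
    also have "\<dots> \<le> e * nsq M f" using \<open>\<kappa> \<le> e\<close> by (intro mult_right_mono) auto
    finally show ?thesis .
  qed
  then show ?thesis using that fin eig by blast
qed

lemma spectral_approx_kop:
  assumes k: "inv_kernel k" and f: "bdd_meas M f"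
  shows "spectral_approx M T (kop M k f)"
proof (rule spectral_approx_limit)
  show "square_integrable M (kop M k f)"
    using k f by (intro bdd_meas_square_integrable bdd_meas_kop) (auto simp: inv_kernel_def)
  fix e :: real assume e: "e > 0"
  define d where "d = e / (nsq M f + 1)"
  have nf: "nsq M f + 1 > 0" using nsq_nonneg[of M f] by linarith
  then have d: "d > 0" using e by (simp add: d_def)
  have "d * nsq M f < d * (nsq M f + 1)" using d by simp
  then have d_less: "d * nsq M f < e" using nf by (simp add: d_def)
  obtain G where G: "finite G" "\<And>w. w \<in> G \<Longrightarrow> bdd_eigen w"
    "\<And>f. bdd_meas M f \<Longrightarrow> nsq M (\<lambda>x. kop M k f x - (\<Sum>w\<in>G. ip M f w * kop M k w x)) \<le> d * nsq M f"
    using kop_eigen_expansion[OF k d] by blast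
  have "spectral_approx M T (\<lambda>x. \<Sum>w\<in>G. ip M f w * kop M k w x)"
    by (intro spectral_approx_sum spectral_approx_cmult bdd_eigen_spectral_approx bdd_eigen_kop k G)
  then show "\<exists>g. spectral_approx M T g \<and> nsq M (\<lambda>x. kop M k f x - g x) < e"
    using G(3)[OF f] d_less by (intro exI[of _ "\<lambda>x. \<Sum>w\<in>G. ip M f w * kop M k w x"]) auto
qed

end

section \<open>The maximal ergodic theorem and mean distances\<close>

text \<open>Every tail union contains some \<open>A n\<close> of measure at least \<open>c\<close>,
  and finite measures are continuous from above. This substitutes for a convergence of the sets
  \<open>A n\<close>.\<close>

lemma (in finite_measure) measure_frequently_ge:
  fixes A :: "nat \<Rightarrow> 'a set"
  assumes A [measurable]: "\<And>n. A n \<in> sets M" and freq: "\<exists>\<^sub>\<infinity>n. c \<le> measure M (A n)"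
  shows "c \<le> measure M {x\<in>space M. \<exists>\<^sub>\<infinity>n. x \<in> A n}"
proof -
  define U where "U m = (\<Union>n\<in>{m<..}. A n)" for m
  have U [measurable]: "U m \<in> sets M" for m unfolding U_def by measurable
  have "decseq U" unfolding U_def decseq_def by fastforce
  then have "(\<lambda>m. measure M (U m)) \<longlonglongrightarrow> measure M (\<Inter>m. U m)"
    by (intro finite_Lim_measure_decseq) auto
  moreover have "c \<le> measure M (U m)" for m
  proof -
    obtain n where n: "n > m" "c \<le> measure M (A n)" using freq unfolding INFM_nat by blast
    have "measure M (A n) \<le> measure M (U m)" using n(1) by (intro finite_measure_mono) (auto simp: U_def)
    then show ?thesis using n(2) by simp
  qed
  ultimately have "c \<le> measure M (\<Inter>m. U m)" by (intro LIMSEQ_le_const) auto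
  also have "(\<Inter>m. U m) = {x\<in>space M. \<exists>\<^sub>\<infinity>n. x \<in> A n}"
    using A[THEN sets.sets_into_space] by (auto simp: U_def INFM_nat Bex_def) blast
  finally show ?thesis .
qed

context measure_preserving
begin

text \<open>Garsia's proof of the maximal ergodic theorem: \<open>m (Suc n)\<close> is the maximum of zero and the
  first \<open>Suc n\<close> Birkhoff sums of \<open>g\<close>.\<close>
lemma maximal_ergodic:
  fixes g :: "'a \<Rightarrow> real"
  assumes g: "integrable M g"
    and pos: "\<And>x. x \<in> space M \<Longrightarrow> g x \<noteq> 0 \<Longrightarrow> \<exists>n. (\<Sum>i<n. g ((T ^^ i) x)) > 0"
  shows "0 \<le> (\<integral>x. g x \<partial>M)"
proof -
  have g_meas [measurable]: "g \<in> borel_measurable M" using g by auto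
  define m where "m = rec_nat (\<lambda>x. 0) (\<lambda>n f x. max 0 (g x + f (T x)))"
  have m0: "m 0 x = 0" and mS: "m (Suc n) x = max 0 (g x + m n (T x))" for n x
    by (simp_all add: m_def)
  have mS': "m (Suc n) = (\<lambda>x. max 0 (g x + m n (T x)))" for n by (simp add: fun_eq_iff mS)
  have intT: "integrable M (\<lambda>x. f (T x))" if "integrable M f" for f :: "'a \<Rightarrow> real"
    using that integrable_distr[OF T_meas, of f] by (simp add: T_inv)
  have m_int: "integrable M (m n)" for n
  proof (induction n)
    case 0
    have "m 0 = (\<lambda>x. 0)" by (simp add: fun_eq_iff m0)
    then show ?case by simp
  next
    case (Suc n)
    then show ?case unfolding mS' using g intT[OF Suc] by auto
  qed
  have m_meas [measurable]: "m n \<in> borel_measurable M" for n using m_int by auto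
  have m_mono: "m n x \<le> m (Suc n) x" for n x
  proof (induction n arbitrary: x)
    case (Suc n)
    show ?case using Suc[of "T x"] by (simp add: mS[of n] mS[of "Suc n"])
  qed (simp add: m0 mS)
  have m_nn: "0 \<le> m n x" for n x by (cases n) (auto simp: m0 mS)
  have S_le: "(\<Sum>i<n. g ((T ^^ i) x)) \<le> m n x" for n x
  proof (induction n arbitrary: x)
    case (Suc n)
    have "(\<Sum>i<Suc n. g ((T ^^ i) x)) = g x + (\<Sum>i<n. g ((T ^^ i) (T x)))"
      by (simp add: sum.lessThan_Suc_shift funpow_swap1 del: sum.lessThan_Suc)
    then show ?case using Suc[of "T x"] by (simp add: mS)
  qed (simp add: m0)
  define E where "E n x = (if m (Suc n) x > 0 then g x else 0)" for n x
  have E_meas [measurable]: "E n \<in> borel_measurable M" for n unfolding E_def by measurable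
  have E_int: "integrable M (E n)" for n
    by (rule Bochner_Integration.integrable_bound[OF g]) (auto simp: E_def)
  have "0 \<le> (\<integral>x. E n x \<partial>M)" for n
  proof -
    have "(\<integral>x. m n x \<partial>M) \<le> (\<integral>x. m (Suc n) x \<partial>M)"
      by (intro integral_mono m_int m_mono)
    then have "0 \<le> (\<integral>x. m (Suc n) x \<partial>M) - (\<integral>x. m n (T x) \<partial>M)"
      using integral_T[of "m n"] by simp
    also have "\<dots> = (\<integral>x. m (Suc n) x - m n (T x) \<partial>M)"
      by (subst Bochner_Integration.integral_diff) (auto intro: m_int intT)
    also have "\<dots> \<le> (\<integral>x. E n x \<partial>M)"
    proof (rule integral_mono)
      show "integrable M (\<lambda>x. m (Suc n) x - m n (T x))" using m_int intT[OF m_int] by auto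
      \<comment> \<open>Equality holds where the maximum is positive; elsewhere the left side is
        \<open>- m n (T x)\<close>, which is at most 0, and the right side is 0.\<close>
      show "m (Suc n) x - m n (T x) \<le> E n x" for x
        using m_nn[of n "T x"] by (auto simp: E_def mS)
    qed (rule E_int)
    finally show ?thesis .
  qed
  moreover have "(\<lambda>n. \<integral>x. E n x \<partial>M) \<longlonglongrightarrow> (\<integral>x. g x \<partial>M)"
  proof (rule integral_dominated_convergence[where w = "\<lambda>x. \<bar>g x\<bar>"])
    show "AE x in M. (\<lambda>n. E n x) \<longlonglongrightarrow> g x"
    proof (rule AE_I2)
      fix x assume x: "x \<in> space M"
      show "(\<lambda>n. E n x) \<longlonglongrightarrow> g x"
      \<comment> \<open>Where \<open>g\<close> vanishes the cutoff \<open>E\<close> changes nothing;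
        elsewhere \<open>pos\<close> makes \<open>m n x\<close> positive from some \<open>n\<close>
        on. In this way \<open>g\<close> may be supported on an invariant set outside of which
        nothing is known.\<close>
      proof (cases "g x = 0")
        case True
        then have "E n x = 0" for n by (simp add: E_def)
        then show ?thesis using True by simp
      next
        case False
        then obtain N where N: "m N x > 0" using pos[OF x] S_le less_le_trans by blast
        have "m n x > 0" if "n \<ge> N" for n
          using N lift_Suc_mono_le[of "\<lambda>n. m n x", OF m_mono that] by simp
        then have "\<forall>n\<ge>N. E n x = g x" by (auto simp: E_def)
        then show ?thesis by (intro tendsto_eventually) (auto simp: eventually_sequentially)
      qed
    qed
    show "AE x in M. norm (E n x) \<le> \<bar>g x\<bar>" for n by (auto simp: E_def)
  qed (use g in auto)
  ultimately show ?thesis by (intro LIMSEQ_le_const) auto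
qed

lemma measure_preserving_pair: "measure_preserving (M \<Otimes>\<^sub>M M) (\<lambda>(x, y). (T x, T y))"
proof -
  interpret P: pair_prob_space M M ..
  have "distr M M T \<Otimes>\<^sub>M distr M M T = distr (M \<Otimes>\<^sub>M M) (M \<Otimes>\<^sub>M M) (\<lambda>(x, y). (T x, T y))"
    by (intro pair_measure_distr T_meas) (simp add: T_inv sigma_finite_measure_axioms)
  then show ?thesis
    by unfold_locales (simp_all add: T_inv)
qed

section \<open>Pointwise limits within the closed span\<close>

lemma spectral_approx_cong:
  assumes "spectral_approx M T g" "\<And>x. x \<in> space M \<Longrightarrow> f x = g x"
  shows "spectral_approx M T f"
proof (rule spectral_approx_limit)
  have "f \<in> borel_measurable M \<longleftrightarrow> g \<in> borel_measurable M" using assms(2) by (intro measurable_cong)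
  moreover have "integrable M (\<lambda>x. (cmod (f x))\<^sup>2) \<longleftrightarrow> integrable M (\<lambda>x. (cmod (g x))\<^sup>2)"
    using assms(2) by (intro Bochner_Integration.integrable_cong) auto
  ultimately show "square_integrable M f" using assms(1) by (simp add: spectral_approx_def square_integrable_def)
  fix e :: real assume "e > 0"
  moreover have "nsq M (\<lambda>x. f x - g x) = nsq M (\<lambda>x. 0)" using assms(2) by (intro nsq_cong) auto
  ultimately show "\<exists>g. spectral_approx M T g \<and> nsq M (\<lambda>x. f x - g x) < e"
    using assms(1) by (intro exI[of _ g]) (simp add: nsq_def)
qed

lemma spectral_approx_dominated:
  assumes u: "\<And>n. spectral_approx M T (u n)" and f [measurable]: "f \<in> borel_measurable M"
    and lim: "\<And>x. x \<in> space M \<Longrightarrow> (\<lambda>n. u n x) \<longlonglongrightarrow> f x"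
    and w: "integrable M (\<lambda>x. (w x)\<^sup>2)" and dom: "\<And>n x. x \<in> space M \<Longrightarrow> cmod (u n x) \<le> w x"
  shows "spectral_approx M T f"
proof (rule spectral_approx_limit)
  have u_meas [measurable]: "u n \<in> borel_measurable M" for n
    using u[of n] by (simp add: spectral_approx_def square_integrable_def)
  have fw: "cmod (f x) \<le> w x" if x: "x \<in> space M" for x
    using tendsto_norm[OF lim[OF x]] dom[OF x] by (intro LIMSEQ_le_const2) auto
  have w0: "0 \<le> w x" if "x \<in> space M" for x using dom[OF that, of 0] norm_ge_zero order_trans by blast
  show "square_integrable M f" unfolding square_integrable_def
    using fw by (auto intro!: Bochner_Integration.integrable_bound[OF w] AE_I2 power_mono)
  have "(\<lambda>n. \<integral>x. (cmod (f x - u n x))\<^sup>2 \<partial>M) \<longlonglongrightarrow> (\<integral>x. 0 \<partial>M)"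
  proof (rule integral_dominated_convergence[where w = "\<lambda>x. 4 * (w x)\<^sup>2"])
    show "AE x in M. (\<lambda>n. (cmod (f x - u n x))\<^sup>2) \<longlonglongrightarrow> 0"
    proof (rule AE_I2)
      fix x assume "x \<in> space M"
      then have "(\<lambda>n. (cmod (f x - u n x))\<^sup>2) \<longlonglongrightarrow> (cmod (f x - f x))\<^sup>2"
        by (intro tendsto_intros lim)
      then show "(\<lambda>n. (cmod (f x - u n x))\<^sup>2) \<longlonglongrightarrow> 0" by simp
    qed
    show "AE x in M. norm ((cmod (f x - u n x))\<^sup>2) \<le> 4 * (w x)\<^sup>2" for n
    proof (rule AE_I2)
      fix x assume x: "x \<in> space M"
      have "cmod (f x - u n x) \<le> 2 * w x"
        using norm_triangle_ineq4[of "f x" "u n x"] fw[OF x] dom[OF x, of n] by simp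
      then have "(cmod (f x - u n x))\<^sup>2 \<le> (2 * w x)\<^sup>2" by (intro power_mono) auto
      then show "norm ((cmod (f x - u n x))\<^sup>2) \<le> 4 * (w x)\<^sup>2" by (simp add: power_mult_distrib)
    qed
  qed (use w in auto)
  then have nlim: "(\<lambda>n. nsq M (\<lambda>x. f x - u n x)) \<longlonglongrightarrow> 0" by (simp add: nsq_def)
  fix e :: real assume "e > 0"
  then obtain n where "nsq M (\<lambda>x. f x - u n x) < e"
    using order_tendstoD(2)[OF nlim] by (auto simp: eventually_sequentially)
  then show "\<exists>g. spectral_approx M T g \<and> nsq M (\<lambda>x. f x - g x) < e" using u by blast
qed

end

section \<open>Compact metric systems: measurability of distances and finite nets\<close>

locale metric_system = measure_preserving M T
  for M :: "'a::metric_space measure" and T :: "'a \<Rightarrow> 'a" +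
  fixes X :: "'a set"
  assumes compact_X: "compact X" and sets_M: "sets M = sets (restrict_space borel X)"
    and cont_T: "continuous_on X T"
begin

lemma space_M: "space M = X"
  using sets_eq_imp_space_eq[OF sets_M] by (simp add: space_restrict_space)

lemma borel_measurable_continuous:
  fixes f :: "'a \<Rightarrow> 'b::topological_space"
  assumes "continuous_on X f" shows "f \<in> borel_measurable M"
  using borel_measurable_continuous_on_restrict[OF assms] measurable_cong_sets[OF sets_M refl, of borel] by auto

lemma compact_finite_net:
  assumes "e > 0" obtains K where "finite K" "K \<subseteq> X" "\<And>x. x \<in> X \<Longrightarrow> \<exists>z\<in>K. dist z x < e"
proof -
  have "seq_compact X" using compact_X by (rule compact_imp_seq_compact)
  then have "\<exists>K. finite K \<and> K \<subseteq> X \<and> X \<subseteq> (\<Union>x\<in>K. ball x e)"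
    using assms by (rule seq_compact_imp_totally_bounded[rule_format])
  then obtain K where "finite K" "K \<subseteq> X" "X \<subseteq> (\<Union>x\<in>K. ball x e)" by (elim exE conjE)
  then show ?thesis using that[of K] by (auto simp: subset_iff)
qed

text \<open>The type \<open>'a\<close> need not be second countable, so the library's measurability of \<open>dist\<close> does
  not apply; a countable dense subset of \<open>X\<close> takes its place.\<close>
lemma measurable_dist_pair: "(\<lambda>p. dist (fst p) (snd p)) \<in> borel_measurable (M \<Otimes>\<^sub>M M)"
proof -
  have "\<exists>K. finite K \<and> K \<subseteq> X \<and> (\<forall>x\<in>X. \<exists>z\<in>K. dist z x < 1 / real (Suc n))" for n
    by (rule compact_finite_net[of "1 / real (Suc n)"]) auto
  then obtain K where K: "\<And>n. finite (K n)" "\<And>n. K n \<subseteq> X"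
    "\<And>n x. x \<in> X \<Longrightarrow> \<exists>z\<in>K n. dist z x < 1 / real (Suc n)" by metis
  define D where "D = (\<Union>n. K n)"
  have D: "countable D" unfolding D_def using K(1) by (intro countable_UN) (auto intro: countable_finite)
  have dist_meas [measurable]: "dist z \<in> borel_measurable M" for z
    by (intro borel_measurable_continuous continuous_intros)
  show ?thesis unfolding borel_measurable_iff_less
  proof
    fix a :: real
    have "{p \<in> space (M \<Otimes>\<^sub>M M). dist (fst p) (snd p) < a}
        = (\<Union>z\<in>D. {p \<in> space (M \<Otimes>\<^sub>M M). dist z (fst p) + dist z (snd p) < a})"
    proof (intro equalityI subsetI)
      fix p assume "p \<in> {p \<in> space (M \<Otimes>\<^sub>M M). dist (fst p) (snd p) < a}"
      then have p: "p \<in> space (M \<Otimes>\<^sub>M M)" "dist (fst p) (snd p) < a" by auto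
      then have "fst p \<in> X" by (auto simp: space_pair_measure space_M)
      \<comment> \<open>Half of the gap, because \<open>dist z (fst p)\<close> enters twice:
        directly, and through the triangle inequality for \<open>dist z (snd p)\<close>.\<close>
      obtain n where n: "1 / real (Suc n) < (a - dist (fst p) (snd p)) / 2"
        using nat_approx_posE[of "(a - dist (fst p) (snd p)) / 2"] p(2) by auto
      obtain z where z: "z \<in> K n" "dist z (fst p) < 1 / real (Suc n)" using K(3) \<open>fst p \<in> X\<close> by blast
      have "dist z (snd p) \<le> dist z (fst p) + dist (fst p) (snd p)" by (rule dist_triangle)
      moreover have "dist z (fst p) < (a - dist (fst p) (snd p)) / 2" using z(2) n by (rule less_trans)
      ultimately have "dist z (fst p) + dist z (snd p) < a" by simp
      then show "p \<in> (\<Union>z\<in>D. {p \<in> space (M \<Otimes>\<^sub>M M). dist z (fst p) + dist z (snd p) < a})"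
        using z p by (auto simp: D_def)
    next
      fix p assume "p \<in> (\<Union>z\<in>D. {p \<in> space (M \<Otimes>\<^sub>M M). dist z (fst p) + dist z (snd p) < a})"
      then obtain z where "p \<in> space (M \<Otimes>\<^sub>M M)" "dist z (fst p) + dist z (snd p) < a" by auto
      then show "p \<in> {p \<in> space (M \<Otimes>\<^sub>M M). dist (fst p) (snd p) < a}"
        using dist_triangle3[of "fst p" "snd p" z] by simp
    qed
    also have "\<dots> \<in> sets (M \<Otimes>\<^sub>M M)"
      by (intro sets.countable_UN'[OF D] image_subsetI) measurable
    finally show "{p \<in> space (M \<Otimes>\<^sub>M M). dist (fst p) (snd p) < a} \<in> sets (M \<Otimes>\<^sub>M M)" .
  qed
qed

lemma measurable_dbar: "(\<lambda>p. dbar T n (fst p) (snd p)) \<in> borel_measurable (M \<Otimes>\<^sub>M M)"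
proof -
  have "(\<lambda>p. dist ((T ^^ i) (fst p)) ((T ^^ i) (snd p))) \<in> borel_measurable (M \<Otimes>\<^sub>M M)" for i
  proof -
    have "(\<lambda>p. ((T ^^ i) (fst p), (T ^^ i) (snd p))) \<in> measurable (M \<Otimes>\<^sub>M M) (M \<Otimes>\<^sub>M M)" by measurable
    from measurable_compose[OF this measurable_dist_pair] show ?thesis by simp
  qed
  then show ?thesis unfolding dbar_def by measurable
qed

lemma measurable_dbar_row:
  assumes "x \<in> X" shows "(\<lambda>y. dbar T n x y) \<in> borel_measurable M"
  using measurable_compose[OF _ measurable_dbar, of "\<lambda>y. (x, y)" M n] assms by (simp add: space_M)

lemma dist_bound: obtains B where "B > 0" "\<And>x y. x \<in> X \<Longrightarrow> y \<in> X \<Longrightarrow> dist x y \<le> B"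
proof -
  have b: "bounded X" using compact_X by (rule compact_imp_bounded)
  have "dist x y \<le> diameter X + 1" if "x \<in> X" "y \<in> X" for x y
    using diameter_bounded_bound[OF b that] by simp
  moreover have "diameter X + 1 > 0" using diameter_ge_0[OF b] by simp
  ultimately show ?thesis using that by blast
qed

section \<open>Pairs that are close on average infinitely often\<close>

lemma dbar_T: "dbar T n (T x) (T y) = dbar T n x y + (dist ((T ^^ n) x) ((T ^^ n) y) - dist x y) / n"
proof -
  have "(\<Sum>i<n. dist ((T ^^ i) (T x)) ((T ^^ i) (T y))) + dist x y
      = (\<Sum>i<Suc n. dist ((T ^^ i) x) ((T ^^ i) y))"
    by (simp add: sum.lessThan_Suc_shift funpow_swap1 del: sum.lessThan_Suc)
  then have "(\<Sum>i<n. dist ((T ^^ i) (T x)) ((T ^^ i) (T y)))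
      = (\<Sum>i<n. dist ((T ^^ i) x) ((T ^^ i) y)) + (dist ((T ^^ n) x) ((T ^^ n) y) - dist x y)" by simp
  then show ?thesis by (simp add: dbar_def add_divide_distrib)
qed

text \<open>\<open>liminf\<^sub>n dbar T n x y < \<eta>\<close>\<close>
definition near :: "real \<Rightarrow> 'a \<Rightarrow> 'a \<Rightarrow> bool" where
  "near \<eta> x y \<longleftrightarrow> (\<exists>j. \<exists>\<^sub>\<infinity>n. dbar T n x y < \<eta> - 1 / real (Suc j))"

text \<open>The definition runs through countably many slacks, which makes measurability evident;
  estimates are simpler with an arbitrary positive slack.\<close>

lemma near_iff: "near \<eta> x y \<longleftrightarrow> (\<exists>\<delta>>0. \<exists>\<^sub>\<infinity>n. dbar T n x y < \<eta> - \<delta>)"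
proof
  assume "near \<eta> x y"
  then show "\<exists>\<delta>>0. \<exists>\<^sub>\<infinity>n. dbar T n x y < \<eta> - \<delta>"
    unfolding near_def using of_nat_0_less_iff zero_less_Suc zero_less_divide_1_iff by metis
next
  assume "\<exists>\<delta>>0. \<exists>\<^sub>\<infinity>n. dbar T n x y < \<eta> - \<delta>"
  then obtain \<delta> where \<delta>: "\<delta> > 0" "\<exists>\<^sub>\<infinity>n. dbar T n x y < \<eta> - \<delta>" by blast
  obtain j where j: "1 / real (Suc j) < \<delta>" using nat_approx_posE[OF \<delta>(1)] by blast
  have "\<exists>\<^sub>\<infinity>n. dbar T n x y < \<eta> - 1 / real (Suc j)"
    using \<delta>(2) by (rule INFM_mono) (use j in auto)
  then show "near \<eta> x y" unfolding near_def by blast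
qed

text \<open>Shifting the orbit segment by one changes \<open>dbar T n\<close> by at most
  \<open>B / n\<close>, with \<open>B\<close> a bound for the distances in \<open>X\<close>. For
  large \<open>n\<close> half of the slack absorbs this, in either direction.\<close>

lemma near_T: 
  assumes xy: "x \<in> X" "y \<in> X" shows "near \<eta> (T x) (T y) \<longleftrightarrow> near \<eta> x y"
proof -
  obtain B where B: "B > 0" "\<And>x y. x \<in> X \<Longrightarrow> y \<in> X \<Longrightarrow> dist x y \<le> B" using dist_bound by blast
  have close: "\<bar>dbar T n (T x) (T y) - dbar T n x y\<bar> \<le> B / n" for n
  proof -
    have "dist ((T ^^ n) x) ((T ^^ n) y) \<le> B" using xy Tpow_space by (intro B(2)) (auto simp: space_M)
    then have "\<bar>dist ((T ^^ n) x) ((T ^^ n) y) - dist x y\<bar> \<le> B"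
      using B(2)[OF xy] zero_le_dist[of x y] zero_le_dist[of "(T ^^ n) x" "(T ^^ n) y"] by linarith
    then show ?thesis by (simp add: dbar_T divide_right_mono)
  qed
  have *: "\<exists>\<delta>>0. \<exists>\<^sub>\<infinity>n. b n < \<eta> - \<delta>"
    if ab: "\<And>n. \<bar>a n - b n\<bar> \<le> B / real n" and a: "\<exists>\<delta>>0. \<exists>\<^sub>\<infinity>n. a n < \<eta> - \<delta>" for a b :: "nat \<Rightarrow> real"
  proof -
    obtain \<delta> where \<delta>: "\<delta> > 0" "\<exists>\<^sub>\<infinity>n. a n < \<eta> - \<delta>" using a by blast
    have "(\<lambda>n. B / real n) \<longlonglongrightarrow> 0" by (rule lim_const_over_n)
    then have ev: "\<forall>\<^sub>F n in sequentially. B / real n < \<delta> / 2" using \<delta>(1) by (intro order_tendstoD(2)[of _ 0]) auto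
    have "\<exists>\<^sub>F n in sequentially. b n < \<eta> - \<delta> / 2"
    proof (rule frequently_rev_mp)
      show "\<exists>\<^sub>F n in sequentially. a n < \<eta> - \<delta>" using \<delta>(2) by (simp add: cofinite_eq_sequentially)
      show "\<forall>\<^sub>F n in sequentially. a n < \<eta> - \<delta> \<longrightarrow> b n < \<eta> - \<delta> / 2"
        using ev
      proof eventually_elim
        case (elim n)
        show ?case using ab[of n] elim by linarith
      qed
    qed
    then show ?thesis using \<delta>(1) by (intro exI[of _ "\<delta> / 2"]) (simp add: cofinite_eq_sequentially)
  qed
  show ?thesis unfolding near_iff
    using *[OF close] *[of "\<lambda>n. dbar T n x y" "\<lambda>n. dbar T n (T x) (T y)"] close
    by (auto simp: abs_minus_commute)
qed

lemma near_Tpow: "x \<in> X \<Longrightarrow> y \<in> X \<Longrightarrow> near \<eta> ((T ^^ n) x) ((T ^^ n) y) \<longleftrightarrow> near \<eta> x y"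
  by (induction n) (use near_T Tpow_space in \<open>auto simp: space_M\<close>)

definition near_ind :: "real \<Rightarrow> 'a \<Rightarrow> 'a \<Rightarrow> real" where
  "near_ind \<eta> x y = (if near \<eta> x y then 1 else 0)"

lemma measurable_near_ind [measurable]: "(\<lambda>p. near_ind \<eta> (fst p) (snd p)) \<in> borel_measurable (M \<Otimes>\<^sub>M M)"
proof -
  have [measurable]: "(\<lambda>p. dbar T n (fst p) (snd p)) \<in> borel_measurable (M \<Otimes>\<^sub>M M)" for n
    by (rule measurable_dbar)
  show ?thesis unfolding near_ind_def near_def INFM_nat by measurable
qed

lemma measurable_near_ind_row:
  assumes "x \<in> X" shows "near_ind \<eta> x \<in> borel_measurable M"
  using measurable_compose[OF _ measurable_near_ind, of "\<lambda>y. (x, y)" M \<eta>] assms by (simp add: space_M)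

text \<open>As an integral over the second variable it is measurable in \<open>x\<close> by the
  Fubini machinery; \<open>near_mass_eq_measure\<close> identifies it with the measure of the
  section.\<close>

definition near_mass :: "real \<Rightarrow> 'a \<Rightarrow> real" where
  "near_mass \<eta> x = (\<integral>y. near_ind \<eta> x y \<partial>M)"

lemma measurable_near_mass [measurable]: "near_mass \<eta> \<in> borel_measurable M"
  unfolding near_mass_def[abs_def]
  using borel_measurable_lebesgue_integral[of "\<lambda>x y. near_ind \<eta> x y" M] measurable_near_ind[of \<eta>]
  by (simp add: case_prod_beta')

lemma near_mass_T: "x \<in> X \<Longrightarrow> near_mass \<eta> (T x) = near_mass \<eta> x"
proof -
  assume x: "x \<in> X"
  then have Tx: "T x \<in> X" using T_space by (simp add: space_M)
  have "near_mass \<eta> (T x) = (\<integral>y. near_ind \<eta> (T x) (T y) \<partial>M)"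
    unfolding near_mass_def by (rule integral_T[symmetric]) (rule measurable_near_ind_row[OF Tx])
  also have "\<dots> = near_mass \<eta> x" unfolding near_mass_def
    by (intro Bochner_Integration.integral_cong) (auto simp: near_ind_def near_T x space_M)
  finally show ?thesis .
qed

lemma near_sets:
  assumes "x \<in> X" shows "{y\<in>space M. near \<eta> x y} \<in> sets M"
proof -
  have [measurable]: "near_ind \<eta> x \<in> borel_measurable M" using assms by (rule measurable_near_ind_row)
  have "{y\<in>space M. near_ind \<eta> x y = 1} \<in> sets M" by measurable
  also have "{y\<in>space M. near_ind \<eta> x y = 1} = {y\<in>space M. near \<eta> x y}"
    by (auto simp: near_ind_def split: if_splits)
  finally show ?thesis .
qed

lemma near_mass_eq_measure:
  assumes x: "x \<in> X" shows "near_mass \<eta> x = measure M {y\<in>space M. near \<eta> x y}"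
proof -
  have "near_mass \<eta> x = (\<integral>y. indicator {y\<in>space M. near \<eta> x y} y \<partial>M)"
    unfolding near_mass_def by (intro Bochner_Integration.integral_cong) (auto simp: near_ind_def indicator_def)
  then show ?thesis using near_sets[OF x, of \<eta>] by simp
qed

section \<open>Bounded complexity and the mass of the sections\<close>

lemma dbar_commute: "dbar T n x y = dbar T n y x"
  by (simp add: dbar_def dist_commute)

lemma dbar_triangle: "dbar T n x z \<le> dbar T n x y + dbar T n y z"
  unfolding dbar_def distrib_left[symmetric] sum.distrib[symmetric]
  by (intro mult_left_mono sum_mono dist_triangle) auto

lemma continuous_on_Tpow: "continuous_on X (T ^^ n)"
proof (induction n)
  case (Suc n)
  have "(T ^^ n) ` X \<subseteq> X" using Tpow_space by (auto simp: space_M)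
  then have "continuous_on X (T \<circ> (T ^^ n))"
    using Suc continuous_on_subset[OF cont_T] by (intro continuous_on_compose) auto
  then show ?case by simp
qed (simp add: id_def)

text \<open>A net for a common modulus of uniform continuity of the first \<open>n\<close> iterates
  will do. Its existence shows that the minimum in \<open>span_bar\<close> is taken over a nonempty
  set, so that \<open>LEAST\<close> is attained.\<close>

lemma dbar_finite_net:
  assumes n: "n \<ge> 1" and e: "e > 0"
  obtains F where "finite F" "F \<subseteq> X" "(\<Union>x\<in>F. dbar_ball X T n x e) = X"
proof -
  have "\<exists>r>0. \<forall>x\<in>X. \<forall>y\<in>X. dist x y < r \<longrightarrow> dist ((T ^^ i) x) ((T ^^ i) y) < e" for i
    using compact_uniformly_continuous[OF continuous_on_Tpow[of i] compact_X] e
    unfolding uniformly_continuous_on_def by (metis dist_commute)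
  then obtain r where r: "\<And>i. r i > 0"
    "\<And>i x y. x \<in> X \<Longrightarrow> y \<in> X \<Longrightarrow> dist x y < r i \<Longrightarrow> dist ((T ^^ i) x) ((T ^^ i) y) < e" by metis
  define d where "d = Min (r ` {..<n})"
  have "d > 0" unfolding d_def using n r(1) by (subst Min_gr_iff) (auto simp: lessThan_empty_iff)
  then obtain F where F: "finite F" "F \<subseteq> X" "\<And>x. x \<in> X \<Longrightarrow> \<exists>z\<in>F. dist z x < d"
    using compact_finite_net by blast
  have "dbar T n z x < e" if "z \<in> X" "x \<in> X" "dist z x < d" for z x
  proof -
    have "d \<le> r i" if "i < n" for i unfolding d_def using that by (intro Min_le) auto
    then have "dist z x < r i" if "i < n" for i using \<open>dist z x < d\<close> that less_le_trans by blast
    then have "(\<Sum>i<n. dist ((T ^^ i) z) ((T ^^ i) x)) < (\<Sum>i<n. e)"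
      using n that r(2) by (intro sum_strict_mono) (auto simp: lessThan_empty_iff)
    then show ?thesis using n by (simp add: dbar_def field_simps)
  qed
  then have "(\<Union>x\<in>F. dbar_ball X T n x e) = X"
    using F(2,3) by (fastforce simp: dbar_ball_def)
  then show ?thesis using that F by blast
qed

lemma span_bar_attained:
  assumes "n \<ge> 1" "e > 0"
  obtains F where "finite F" "F \<subseteq> X" "card F = span_bar X T M n e"
    "measure M (\<Union>x\<in>F. dbar_ball X T n x e) > 1 - e"
proof -
  obtain F where F: "finite F" "F \<subseteq> X" "(\<Union>x\<in>F. dbar_ball X T n x e) = X"
    using dbar_finite_net[OF assms] by blast
  have "measure M (\<Union>x\<in>F. dbar_ball X T n x e) > 1 - e"
    unfolding F(3) using prob_space assms(2) by (simp add: space_M)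
  then have "\<exists>k F. F \<subseteq> X \<and> finite F \<and> card F = k \<and> measure M (\<Union>x\<in>F. dbar_ball X T n x e) > 1 - e"
    using F by blast
  from LeastI_ex[OF this] show ?thesis using that unfolding span_bar_def by blast
qed

lemma dbar_ball_sets: "x \<in> X \<Longrightarrow> dbar_ball X T n x e \<in> sets M"
proof -
  assume "x \<in> X"
  then have [measurable]: "(\<lambda>y. dbar T n x y) \<in> borel_measurable M" by (rule measurable_dbar_row)
  have "{y \<in> space M. dbar T n x y < e} \<in> sets M" by measurable
  then show ?thesis by (simp add: dbar_ball_def space_M)
qed

text \<open>For each \<open>n\<close>, at most \<open>C\<close> balls of radius \<open>e\<close>
  cover all but measure \<open>e\<close>. Discarding those of mass below \<open>e / C\<close> loses
  less than \<open>e\<close> or nothing, and a point of a remaining ball sees that whole ball within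
  radius \<open>2 * e\<close> of itself. So for every \<open>n\<close> all points outside a set of
  measure \<open>2 * e\<close> have heavy balls. \<open>measure_frequently_ge\<close> makes this
  independent of \<open>n\<close>, once for the points \<open>x\<close> and once for their
  neighbours \<open>y\<close>.\<close>

lemma near_mass_lower_bound:
  assumes bc: "bounded_complexity X T M" and \<eta>: "\<eta> > 0"
  obtains \<delta> where "\<delta> > 0" "1 - \<eta> / 2 \<le> measure M {x\<in>space M. \<delta> \<le> near_mass \<eta> x}"
proof -
  \<comment> \<open>Both the exceptional measure and the doubled radius come out as
    \<open>2 * e = \<eta> / 2\<close>; the radius thus leaves the slack \<open>\<eta> / 2\<close>
    that \<open>near\<close> demands.\<close>
  define e where "e = \<eta> / 4"
  have e: "e > 0" using \<eta> by (simp add: e_def)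
  obtain C :: nat where C: "C > 0" "\<And>n. n \<ge> 1 \<Longrightarrow> span_bar X T M n e \<le> C"
    using bc e unfolding bounded_complexity_def by blast
  define \<delta> where "\<delta> = e / C"
  have \<delta>: "\<delta> > 0" using e C by (simp add: \<delta>_def)
  define p where "p n x = measure M (dbar_ball X T n x (2 * e))" for n x
  define A where "A n = {x\<in>space M. \<delta> \<le> p n x}" for n
  have A_sets [measurable]: "A n \<in> sets M" for n
  proof -
    have [measurable]: "(\<lambda>p. dbar T n (fst p) (snd p)) \<in> borel_measurable (M \<Otimes>\<^sub>M M)" by (rule measurable_dbar)
    define c where "c x y = (if dbar T n x y < 2 * e then 1 else 0 :: real)" for x y
    have "(\<lambda>p. c (fst p) (snd p)) \<in> borel_measurable (M \<Otimes>\<^sub>M M)" unfolding c_def by measurable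
    then have "(\<lambda>x. \<integral>y. c x y \<partial>M) \<in> borel_measurable M"
      using borel_measurable_lebesgue_integral[of c M] by (simp add: case_prod_beta')
    moreover have "p n x = (\<integral>y. c x y \<partial>M)" if "x \<in> space M" for x
    proof -
      have "p n x = (\<integral>y. indicator (dbar_ball X T n x (2 * e)) y \<partial>M)"
        using dbar_ball_sets[of x n "2 * e", THEN sets.Int_space_eq2] that by (simp add: p_def space_M)
      also have "\<dots> = (\<integral>y. c x y \<partial>M)"
        by (intro Bochner_Integration.integral_cong) (auto simp: dbar_ball_def space_M indicator_def c_def)
      finally show ?thesis .
    qed
    ultimately have [measurable]: "p n \<in> borel_measurable M" by (simp cong: measurable_cong)
    show ?thesis unfolding A_def by measurable
  qed
  have A_ge: "1 - 2 * e \<le> measure M (A n)" if n: "n \<ge> 1" for n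
  proof -
    obtain F where F: "finite F" "F \<subseteq> X" "card F = span_bar X T M n e"
      "measure M (\<Union>x\<in>F. dbar_ball X T n x e) > 1 - e"
      using span_bar_attained[OF n e] by blast
    define Q where "Q = {z\<in>F. measure M (dbar_ball X T n z e) < \<delta>}"
    have Q: "finite Q" "Q \<subseteq> X" "card Q \<le> C"
      using F C(2)[OF n] card_mono[OF F(1), of Q] by (auto simp: Q_def)
    have ball_sets: "\<And>z. z \<in> X \<Longrightarrow> dbar_ball X T n z e \<in> sets M" by (rule dbar_ball_sets)
    have Q_sets: "(\<Union>z\<in>Q. dbar_ball X T n z e) \<in> sets M"
      using Q ball_sets by (intro sets.finite_UN) auto
    have "(\<Union>z\<in>F. dbar_ball X T n z e) \<subseteq> A n \<union> (\<Union>z\<in>Q. dbar_ball X T n z e)"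
    proof
      fix x assume "x \<in> (\<Union>z\<in>F. dbar_ball X T n z e)"
      then obtain z where z: "z \<in> F" "x \<in> dbar_ball X T n z e" by blast
      show "x \<in> A n \<union> (\<Union>z\<in>Q. dbar_ball X T n z e)"
      proof (cases "z \<in> Q")
        case False
        have x: "x \<in> X" "dbar T n z x < e" using z(2) by (auto simp: dbar_ball_def)
        have "dbar_ball X T n z e \<subseteq> dbar_ball X T n x (2 * e)"
        proof
          fix y assume "y \<in> dbar_ball X T n z e"
          then have "y \<in> X" "dbar T n z y < e" by (auto simp: dbar_ball_def)
          then show "y \<in> dbar_ball X T n x (2 * e)"
            using dbar_triangle[of n x y z] dbar_commute[of n x z] x by (simp add: dbar_ball_def)
        qed
        then have "measure M (dbar_ball X T n z e) \<le> p n x"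
          unfolding p_def using dbar_ball_sets[OF x(1)] by (intro finite_measure_mono)
        then show ?thesis using False z(1) x(1) by (auto simp: Q_def A_def space_M)
      qed (use z in blast)
    qed
    then have "measure M (\<Union>z\<in>F. dbar_ball X T n z e)
        \<le> measure M (A n \<union> (\<Union>z\<in>Q. dbar_ball X T n z e))"
      using A_sets Q_sets by (intro finite_measure_mono) auto
    also have "\<dots> \<le> measure M (A n) + measure M (\<Union>z\<in>Q. dbar_ball X T n z e)"
      using A_sets Q_sets by (intro measure_subadditive) auto
    also have "measure M (\<Union>z\<in>Q. dbar_ball X T n z e) \<le> (\<Sum>z\<in>Q. measure M (dbar_ball X T n z e))"
      using Q ball_sets by (intro finite_measure_subadditive_finite) auto
    also have "\<dots> \<le> (\<Sum>z\<in>Q. \<delta>)" by (intro sum_mono) (auto simp: Q_def)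
    also have "\<dots> \<le> C * \<delta>" using Q(3) \<delta> by simp
    also have "C * \<delta> = e" using C(1) by (simp add: \<delta>_def)
    finally show ?thesis using F(4) by simp
  qed
  have "\<exists>\<^sub>\<infinity>n. 1 - 2 * e \<le> measure M (A n)"
    unfolding INFM_nat_le using A_ge by (metis max.cobounded1 max.cobounded2)
  then have "1 - 2 * e \<le> measure M {x\<in>space M. \<exists>\<^sub>\<infinity>n. x \<in> A n}"
    by (intro measure_frequently_ge A_sets)
  also have "\<dots> \<le> measure M {x\<in>space M. \<delta> \<le> near_mass \<eta> x}"
  proof (rule finite_measure_mono)
    show "{x\<in>space M. \<exists>\<^sub>\<infinity>n. x \<in> A n} \<subseteq> {x\<in>space M. \<delta> \<le> near_mass \<eta> x}"
    proof safe
      fix x assume x: "x \<in> space M" and freq: "\<exists>\<^sub>\<infinity>n. x \<in> A n"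
      then have xX: "x \<in> X" by (simp add: space_M)
      have "\<exists>\<^sub>\<infinity>n. \<delta> \<le> measure M (dbar_ball X T n x (2 * e))"
        using freq by (rule INFM_mono) (simp add: A_def p_def)
      \<comment> \<open>The second passage to infinitely many \<open>n\<close>, now in
        \<open>y\<close> with \<open>x\<close> fixed.\<close>
      then have "\<delta> \<le> measure M {y\<in>space M. \<exists>\<^sub>\<infinity>n. y \<in> dbar_ball X T n x (2 * e)}"
        by (intro measure_frequently_ge dbar_ball_sets xX)
      also have "\<dots> \<le> measure M {y\<in>space M. near \<eta> x y}"
      proof (rule finite_measure_mono)
        show "{y\<in>space M. \<exists>\<^sub>\<infinity>n. y \<in> dbar_ball X T n x (2 * e)} \<subseteq> {y\<in>space M. near \<eta> x y}"
        proof safe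
          fix y assume "\<exists>\<^sub>\<infinity>n. y \<in> dbar_ball X T n x (2 * e)"
          then have "\<exists>\<^sub>\<infinity>n. dbar T n x y < \<eta> - \<eta> / 2"
            by (rule INFM_mono) (simp add: dbar_ball_def e_def)
          then show "near \<eta> x y" unfolding near_iff using \<eta> by (intro exI[of _ "\<eta> / 2"]) simp
        qed
      qed (rule near_sets[OF xX])
      finally show "\<delta> \<le> near_mass \<eta> x" by (simp add: near_mass_eq_measure xX)
    qed
    show "{x\<in>space M. \<delta> \<le> near_mass \<eta> x} \<in> sets M" by measurable
  qed
  finally show ?thesis using that \<delta> by (simp add: e_def)
qed

text \<open>The function \<open>g\<close> is \<open>a * (\<eta> - dist)\<close> with
  \<open>a\<close> the normalised kernel. Since \<open>a\<close> is constant along orbits of pairs,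
  the Birkhoff sums of \<open>g\<close> are \<open>a\<close> times
  \<open>n * (\<eta> - dbar T n)\<close>; where \<open>a\<close> is nonzero the pair is
  \<open>near\<close>, so one of them is positive. The maximal ergodic theorem gives
  \<open>0 \<le> \<integral> g\<close>, and \<open>a\<close> has total mass at most 1.\<close>

lemma integral_near_dist_le:
  assumes \<eta>: "\<eta> > 0" and \<delta>: "\<delta> > 0"
  defines "w \<equiv> \<lambda>x. if \<delta> \<le> near_mass \<eta> x then 1 / near_mass \<eta> x else 0"
  shows "(\<integral>x. (\<integral>y. w x * near_ind \<eta> x y * dist x y \<partial>M) \<partial>M) \<le> \<eta>"
    and "integrable M (\<lambda>x. \<integral>y. w x * near_ind \<eta> x y * dist x y \<partial>M)"
proof -
  interpret P: pair_prob_space M M ..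
  interpret TT: measure_preserving "M \<Otimes>\<^sub>M M" "\<lambda>(x, y). (T x, T y)" by (rule measure_preserving_pair)
  obtain B where B: "B > 0" "\<And>x y. x \<in> X \<Longrightarrow> y \<in> X \<Longrightarrow> dist x y \<le> B" using dist_bound by blast
  have w_meas [measurable]: "w \<in> borel_measurable M" unfolding w_def by measurable
  have w_bd: "0 \<le> w x" "w x \<le> 1 / \<delta>" for x
    using \<delta> by (auto simp: w_def intro!: divide_left_mono)
  have [measurable]: "(\<lambda>p. dist (fst p) (snd p)) \<in> borel_measurable (M \<Otimes>\<^sub>M M)" by (rule measurable_dist_pair)
  define a where "a p = w (fst p) * near_ind \<eta> (fst p) (snd p)" for p
  define h where "h p = a p * dist (fst p) (snd p)" for p
  define g where "g p = \<eta> * a p - h p" for p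
  have a_meas [measurable]: "a \<in> borel_measurable (M \<Otimes>\<^sub>M M)" unfolding a_def by measurable
  have h_meas [measurable]: "h \<in> borel_measurable (M \<Otimes>\<^sub>M M)" unfolding h_def by measurable
  have a_bd: "0 \<le> a p" "a p \<le> 1 / \<delta>" for p using w_bd[of "fst p"] \<delta> by (auto simp: a_def near_ind_def)
  have a_int: "integrable (M \<Otimes>\<^sub>M M) a"
    by (rule P.integrable_const_bound[where B = "1 / \<delta>"]) (use a_bd in auto)
  have h_int: "integrable (M \<Otimes>\<^sub>M M) h"
  proof (rule P.integrable_const_bound[where B = "1 / \<delta> * B"])
    show "AE p in M \<Otimes>\<^sub>M M. norm (h p) \<le> 1 / \<delta> * B"
    proof (rule AE_I2)
      fix p assume "p \<in> space (M \<Otimes>\<^sub>M M)"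
      then have "dist (fst p) (snd p) \<le> B" using B(2) by (auto simp: space_pair_measure space_M)
      then have "a p * dist (fst p) (snd p) \<le> 1 / \<delta> * B" using a_bd[of p] \<delta> by (intro mult_mono) auto
      then show "norm (h p) \<le> 1 / \<delta> * B" using a_bd[of p] by (simp add: h_def abs_mult)
    qed
  qed measurable
  have pow: "((\<lambda>(x, y). (T x, T y)) ^^ i) p = ((T ^^ i) (fst p), (T ^^ i) (snd p))" for i p
    by (induction i) (auto simp: case_prod_beta')
  have w_T: "w ((T ^^ i) x) = w x" if "x \<in> X" for i x
    using that by (induction i) (use near_mass_T Tpow_space in \<open>auto simp: w_def space_M\<close>)
  have "0 \<le> (\<integral>p. g p \<partial>(M \<Otimes>\<^sub>M M))"
  proof (rule TT.maximal_ergodic)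
    show "integrable (M \<Otimes>\<^sub>M M) g" unfolding g_def using a_int h_int by auto
    fix p assume p: "p \<in> space (M \<Otimes>\<^sub>M M)" and "g p \<noteq> 0"
    then have xy: "fst p \<in> X" "snd p \<in> X" by (auto simp: space_pair_measure space_M)
    have "a p \<noteq> 0" using \<open>g p \<noteq> 0\<close> by (auto simp: g_def h_def)
    then have a_pos: "a p > 0" and near: "near \<eta> (fst p) (snd p)"
      using a_bd(1)[of p] by (auto simp: a_def near_ind_def split: if_splits)
    obtain \<delta>' where d: "\<delta>' > 0" "\<exists>\<^sub>\<infinity>n. dbar T n (fst p) (snd p) < \<eta> - \<delta>'" using near unfolding near_iff by blast
    \<comment> \<open>The index 0 must be avoided, as its Birkhoff sum is empty; infinitely many
      indices always offer a positive one.\<close>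
    then obtain n where n: "n > 0" "dbar T n (fst p) (snd p) < \<eta> - \<delta>'" unfolding INFM_nat by blast
    have gT: "g (((\<lambda>(x, y). (T x, T y)) ^^ i) p)
        = a p * (\<eta> - dist ((T ^^ i) (fst p)) ((T ^^ i) (snd p)))" for i
      by (simp add: pow g_def h_def a_def w_T xy near_ind_def near_Tpow right_diff_distrib)
    have "(\<Sum>i<n. dist ((T ^^ i) (fst p)) ((T ^^ i) (snd p))) = n * dbar T n (fst p) (snd p)"
      using n(1) by (simp add: dbar_def)
    also have "\<dots> < n * \<eta>" using n d(1) by simp
    finally have "(\<Sum>i<n. g (((\<lambda>(x, y). (T x, T y)) ^^ i) p)) > 0"
      unfolding gT sum_distrib_left[symmetric] using a_pos by (simp add: sum_subtractf)
    then show "\<exists>n. (\<Sum>i<n. g (((\<lambda>(x, y). (T x, T y)) ^^ i) p)) > 0" by blast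
  qed
  also have "(\<integral>p. g p \<partial>(M \<Otimes>\<^sub>M M)) = \<eta> * (\<integral>p. a p \<partial>(M \<Otimes>\<^sub>M M)) - (\<integral>p. h p \<partial>(M \<Otimes>\<^sub>M M))"
    unfolding g_def using a_int h_int by simp
  \<comment> \<open>By the choice of \<open>w\<close>, each row of \<open>a\<close> has integral 1
    or 0.\<close>
  also have "(\<integral>p. a p \<partial>(M \<Otimes>\<^sub>M M)) \<le> 1"
  proof -
    have "(\<integral>p. a p \<partial>(M \<Otimes>\<^sub>M M)) = (\<integral>x. (\<integral>y. a (x, y) \<partial>M) \<partial>M)"
      using P.integral_fst'[OF a_int] by simp
    also have "\<dots> \<le> (\<integral>x. 1 \<partial>M)"
    proof (rule integral_mono)
      show "integrable M (\<lambda>x. \<integral>y. a (x, y) \<partial>M)" using P.integrable_fst'[OF a_int] .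
      show "(\<integral>y. a (x, y) \<partial>M) \<le> 1" for x
        using \<delta> by (simp add: a_def w_def flip: near_mass_def)
    qed auto
    finally show ?thesis by (simp add: prob_space)
  qed
  finally have le: "(\<integral>p. h p \<partial>(M \<Otimes>\<^sub>M M)) \<le> \<eta>" using \<eta> by (simp add: mult_left_mono)
  have "(\<integral>p. h p \<partial>(M \<Otimes>\<^sub>M M)) = (\<integral>x. (\<integral>y. h (x, y) \<partial>M) \<partial>M)"
    using P.integral_fst'[OF h_int] by simp
  then show "(\<integral>x. (\<integral>y. w x * near_ind \<eta> x y * dist x y \<partial>M) \<partial>M) \<le> \<eta>"
    using le by (simp add: h_def a_def)
  show "integrable M (\<lambda>x. \<integral>y. w x * near_ind \<eta> x y * dist x y \<partial>M)"
    using P.integrable_fst'[OF h_int] by (simp add: h_def a_def)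
qed

section \<open>From Lipschitz functions over indicators to all square integrable functions\<close>

lemma spectral_approx_Lipschitz:
  fixes f :: "'a \<Rightarrow> real"
  assumes bc: "bounded_complexity X T M"
    and f01: "\<And>x. x \<in> X \<Longrightarrow> 0 \<le> f x \<and> f x \<le> 1" and L: "L \<ge> 0"
    and Lip: "\<And>x y. x \<in> X \<Longrightarrow> y \<in> X \<Longrightarrow> \<bar>f x - f y\<bar> \<le> L * dist x y"
  shows "spectral_approx M T (\<lambda>x. of_real (f x))"
proof (rule spectral_approx_limit)
  have "L-lipschitz_on X f" using L Lip by (intro lipschitz_onI) (auto simp: dist_real_def)
  then have "continuous_on X f" by (rule lipschitz_on_continuous_on)
  then have f_meas [measurable]: "f \<in> borel_measurable M" by (rule borel_measurable_continuous)
  have f_bdd: "bdd_meas M (\<lambda>x. complex_of_real (f x))"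
    unfolding bdd_meas_def using f01 by (auto intro!: exI[of _ 1] simp: space_M)
  then show "square_integrable M (\<lambda>x. complex_of_real (f x))" by (rule bdd_meas_square_integrable)
  fix e :: real assume e: "e > 0"
  \<comment> \<open>The error will be \<open>L * \<eta>\<close> from the mean distances plus
    \<open>\<eta> / 2\<close> from the points of small mass; \<open>L + 1\<close> covers both and is
    positive even for \<open>L = 0\<close>.\<close>
  define \<eta> where "\<eta> = e / (L + 1)"
  have \<eta>: "\<eta> > 0" using e L by (simp add: \<eta>_def)
  have \<eta>_e: "L * \<eta> + \<eta> / 2 < e"
  proof -
    have "(L + 1) * \<eta> = e" using L by (simp add: \<eta>_def)
    then show ?thesis using \<eta> by (simp add: distrib_right)
  qed
  obtain \<delta> where \<delta>: "\<delta> > 0" "1 - \<eta> / 2 \<le> measure M {x\<in>space M. \<delta> \<le> near_mass \<eta> x}"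
    using near_mass_lower_bound[OF bc \<eta>] by blast
  define w where "w = (\<lambda>x. if \<delta> \<le> near_mass \<eta> x then 1 / near_mass \<eta> x else 0)"
  have w_meas [measurable]: "w \<in> borel_measurable M" unfolding w_def by measurable
  have w_bd: "0 \<le> w x" "w x \<le> 1 / \<delta>" for x
    using \<delta> by (auto simp: w_def intro!: divide_left_mono)
  define r where "r x y = w x * near_ind \<eta> x y" for x y
  have r_bd: "0 \<le> r x y" "r x y \<le> 1 / \<delta>" for x y
    using w_bd[of x] \<delta>(1) by (auto simp: r_def near_ind_def)
  define h where "h x = (\<integral>y. r x y * dist x y \<partial>M)" for x
  have h: "(\<integral>x. h x \<partial>M) \<le> \<eta>" "integrable M h"
    using integral_near_dist_le[OF \<eta> \<delta>(1)] unfolding h_def r_def w_def by simp_all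
  define k where "k x y = complex_of_real (r x y)" for x y
  have k: "inv_kernel k"
  proof -
    have "(\<lambda>p. complex_of_real (w (fst p) * near_ind \<eta> (fst p) (snd p))) \<in> borel_measurable (M \<Otimes>\<^sub>M M)"
      by measurable
    then have "case_prod k \<in> borel_measurable (M \<Otimes>\<^sub>M M)" by (simp add: k_def r_def case_prod_beta')
    moreover have "cmod (k x y) \<le> 1 / \<delta>" for x y using r_bd[of x y] by (simp add: k_def)
    moreover have "k (T x) (T y) = k x y" if "x \<in> X" "y \<in> X" for x y
      using that by (simp add: k_def r_def w_def near_mass_T near_ind_def near_T)
    ultimately show ?thesis unfolding inv_kernel_def bdd_kernel_def by (auto simp: space_M)
  qed
  define Z where "Z = {x\<in>space M. \<not> \<delta> \<le> near_mass \<eta> x}"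
  have bound: "(cmod (of_real (f x) - kop M k (\<lambda>x. of_real (f x)) x))\<^sup>2
      \<le> L * h x + indicator Z x" if x: "x \<in> space M" for x
  proof -
    have xX: "x \<in> X" using x by (simp add: space_M)
    have [measurable]: "near_ind \<eta> x \<in> borel_measurable M" using xX by (rule measurable_near_ind_row)
    have r_meas [measurable]: "r x \<in> borel_measurable M" unfolding r_def[abs_def] by measurable
    have rint: "integrable M (\<lambda>y. r x y * u y)"
      if u: "u \<in> borel_measurable M" "\<And>y. y \<in> X \<Longrightarrow> \<bar>u y\<bar> \<le> c" for u :: "'a \<Rightarrow> real" and c
    proof (rule integrable_const_bound[where B = "1 / \<delta> * c"])
      show "AE y in M. norm (r x y * u y) \<le> 1 / \<delta> * c"
      proof (rule AE_I2)
        fix y assume "y \<in> space M"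
        then have "\<bar>u y\<bar> \<le> c" using u(2) by (simp add: space_M)
        then have "r x y * \<bar>u y\<bar> \<le> 1 / \<delta> * c"
          using r_bd[of x y] \<delta>(1) by (intro mult_mono) auto
        then show "norm (r x y * u y) \<le> 1 / \<delta> * c" using r_bd(1)[of x y] by (simp add: abs_mult)
      qed
      show "(\<lambda>y. r x y * u y) \<in> borel_measurable M" using u(1) by measurable
    qed
    obtain B where B: "B > 0" "\<And>x y. x \<in> X \<Longrightarrow> y \<in> X \<Longrightarrow> dist x y \<le> B" using dist_bound by blast
    have dist_meas [measurable]: "dist x \<in> borel_measurable M"
      by (intro borel_measurable_continuous continuous_intros)
    have int_f: "integrable M (\<lambda>y. r x y * f y)" using f01 by (intro rint[of _ 1]) auto
    have int_1: "integrable M (\<lambda>y. r x y)" using rint[of "\<lambda>_. 1" 1] by simp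
    have int_d: "integrable M (\<lambda>y. r x y * dist x y)" using B xX by (intro rint[of _ B]) auto
    have kf: "kop M k (\<lambda>x. of_real (f x)) x = of_real (\<integral>y. r x y * f y \<partial>M)"
      unfolding kop_def k_def of_real_mult[symmetric] by (rule integral_complex_of_real)
    define I where "I = (\<integral>y. r x y * f y \<partial>M)"
    have h_nn: "0 \<le> h x" unfolding h_def using r_bd by (intro integral_nonneg_AE) auto
    have r_total: "(\<integral>y. r x y \<partial>M) = w x * near_mass \<eta> x" by (simp add: r_def near_mass_def)
    have eq: "cmod (of_real (f x) - kop M k (\<lambda>x. of_real (f x)) x) = \<bar>f x - I\<bar>"
      unfolding kf I_def of_real_diff[symmetric] norm_of_real ..
    \<comment> \<open>Off \<open>Z\<close>, the number \<open>I\<close> is an average of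
      \<open>f\<close> against a probability density. Then \<open>I\<close> and \<open>f x\<close>
      both lie in [0, 1], so the square is at most the absolute value, and the mean distance
      \<open>h x\<close> suffices without a second moment. On \<open>Z\<close> the row of the kernel
      is zero and the error is at most 1.\<close>
    have "(f x - I)\<^sup>2 \<le> L * h x + indicator Z x"
    proof (cases "\<delta> \<le> near_mass \<eta> x")
      case True
      then have one: "(\<integral>y. r x y \<partial>M) = 1" using \<delta>(1) by (simp add: r_total w_def)
      have "f x - I = (\<integral>y. r x y * f x \<partial>M) - (\<integral>y. r x y * f y \<partial>M)" by (simp add: one I_def)
      also have "\<dots> = (\<integral>y. r x y * (f x - f y) \<partial>M)"
        unfolding right_diff_distrib using int_1 int_f by (subst Bochner_Integration.integral_diff) auto
      finally have "\<bar>f x - I\<bar> \<le> (\<integral>y. \<bar>r x y * (f x - f y)\<bar> \<partial>M)"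
        using integral_norm_bound[of M "\<lambda>y. r x y * (f x - f y)"] by simp
      also have "\<dots> \<le> (\<integral>y. L * (r x y * dist x y) \<partial>M)"
      proof (rule integral_mono)
        show "integrable M (\<lambda>y. \<bar>r x y * (f x - f y)\<bar>)"
          unfolding right_diff_distrib using int_1 int_f by auto
        show "integrable M (\<lambda>y. L * (r x y * dist x y))" using int_d by auto
        fix y assume "y \<in> space M"
        then have "r x y * \<bar>f x - f y\<bar> \<le> r x y * (L * dist x y)"
          using r_bd Lip xX by (intro mult_left_mono) (auto simp: space_M)
        then show "\<bar>r x y * (f x - f y)\<bar> \<le> L * (r x y * dist x y)"
          using r_bd[of x y] by (simp add: abs_mult mult_ac)
      qed
      also have "\<dots> = L * h x" by (simp add: h_def)
      finally have 1: "\<bar>f x - I\<bar> \<le> L * h x" .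
      have "0 \<le> I" unfolding I_def using r_bd f01 by (intro integral_nonneg_AE) (auto simp: space_M)
      moreover have "I \<le> (\<integral>y. r x y \<partial>M)" unfolding I_def
        using int_f int_1 r_bd f01 by (intro integral_mono) (auto simp: space_M mult_left_le)
      ultimately have "\<bar>f x - I\<bar> \<le> 1" using f01[OF xX] one by auto
      then have "\<bar>f x - I\<bar> * \<bar>f x - I\<bar> \<le> \<bar>f x - I\<bar>" by (intro mult_left_le) auto
      then have "(f x - I)\<^sup>2 \<le> \<bar>f x - I\<bar>" by (simp add: power2_eq_square)
      then show ?thesis using 1 True by (simp add: Z_def)
    next
      case False
      then have "I = 0" by (simp add: I_def r_def w_def)
      have "(f x)\<^sup>2 \<le> 1" using f01[OF xX] by (intro power_le_one) auto
      moreover have "0 \<le> L * h x" using L h_nn by simp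
      ultimately show ?thesis using False x \<open>I = 0\<close> by (simp add: Z_def)
    qed
    then show ?thesis unfolding eq by simp
  qed
  have bad: "Z \<in> sets M" unfolding Z_def by measurable
  then have Z_int: "integrable M (indicator Z :: 'a \<Rightarrow> real)"
    by (intro integrable_real_indicator) (auto simp: less_top[symmetric])
  have "Z = space M - {x\<in>space M. \<delta> \<le> near_mass \<eta> x}" by (auto simp: Z_def)
  then have bad_le: "measure M Z \<le> \<eta> / 2"
    using prob_compl[of "{x\<in>space M. \<delta> \<le> near_mass \<eta> x}"] \<delta>(2) by simp
  have "nsq M (\<lambda>x. of_real (f x) - kop M k (\<lambda>x. of_real (f x)) x)
      \<le> (\<integral>x. L * h x + indicator Z x \<partial>M)"
    unfolding nsq_def
  proof (rule integral_mono)
    show "integrable M (\<lambda>x. (cmod (of_real (f x) - kop M k (\<lambda>x. of_real (f x)) x))\<^sup>2)"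
      using k by (intro bdd_meas_integrable_nsq bdd_meas_diff f_bdd bdd_meas_kop) (simp add: inv_kernel_def)
    show "integrable M (\<lambda>x. L * h x + indicator Z x)"
      using h(2) Z_int by (intro Bochner_Integration.integrable_add) auto
  qed (rule bound)
  also have "\<dots> = L * (\<integral>x. h x \<partial>M) + measure M Z"
    using h(2) bad Z_int by (subst Bochner_Integration.integral_add) auto
  also have "\<dots> \<le> L * \<eta> + \<eta> / 2" using L h(1) bad_le by (intro add_mono mult_left_mono) auto
  also have "\<dots> < e" by (rule \<eta>_e)
  finally show "\<exists>g. spectral_approx M T g \<and> nsq M (\<lambda>x. of_real (f x) - g x) < e"
    using spectral_approx_kop[OF k f_bdd] by blast
qed

lemma indicator_measurable: "A \<in> sets borel \<Longrightarrow> (indicator A :: 'a \<Rightarrow> complex) \<in> borel_measurable M"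
proof -
  assume "A \<in> sets borel"
  then have "X \<inter> A \<in> sets M" by (auto simp: sets_M sets_restrict_space)
  then have "(indicator (X \<inter> A) :: 'a \<Rightarrow> complex) \<in> borel_measurable M" by simp
  then show ?thesis by (subst measurable_cong[of _ _ "indicator (X \<inter> A)"]) (auto simp: space_M indicator_def)
qed

lemma spectral_approx_indicator_open:
  assumes bc: "bounded_complexity X T M" and U: "open U"
  shows "spectral_approx M T (indicator U)"
proof (cases "U = UNIV")
  \<comment> \<open>Treated apart because \<open>infdist\<close> to the empty set is 0, so the
    functions \<open>f n\<close> below would all vanish.\<close>
  case True
  have "spectral_approx M T (\<lambda>x. of_real 1)"
    by (rule spectral_approx_Lipschitz[OF bc, of "\<lambda>_. 1" 0]) auto
  then show ?thesis by (rule spectral_approx_cong) (simp add: True)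
next
  case False
  then have ne: "- U \<noteq> {}" by auto
  \<comment> \<open>Lipschitz functions with constant \<open>n\<close>, equal to 0 off
    \<open>U\<close> and eventually 1 at each point of \<open>U\<close>, because the complement is
    closed.\<close>
  define f where "f n x = min 1 (real n * infdist x (- U))" for n x
  have f01: "0 \<le> f n x \<and> f n x \<le> 1" for n x by (simp add: f_def infdist_nonneg)
  show ?thesis
  proof (rule spectral_approx_dominated[where u = "\<lambda>n x. of_real (f n x)" and w = "\<lambda>_. 1"])
    show "spectral_approx M T (\<lambda>x. of_real (f n x))" for n
    proof (rule spectral_approx_Lipschitz[OF bc, where L = "real n"])
      show "\<bar>f n x - f n y\<bar> \<le> real n * dist x y" for x y
      proof -
        have "\<bar>f n x - f n y\<bar> \<le> \<bar>real n * infdist x (- U) - real n * infdist y (- U)\<bar>"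
          unfolding f_def by linarith
        also have "\<dots> = real n * \<bar>infdist x (- U) - infdist y (- U)\<bar>"
          by (simp add: abs_mult flip: right_diff_distrib)
        also have "\<dots> \<le> real n * dist x y" by (intro mult_left_mono infdist_triangle_abs) auto
        finally show ?thesis .
      qed
    qed (use f01 in auto)
    show "(indicator U :: 'a \<Rightarrow> complex) \<in> borel_measurable M" using U by (intro indicator_measurable) auto
    show "(\<lambda>n. complex_of_real (f n x)) \<longlonglongrightarrow> indicator U x" for x
    proof (cases "x \<in> U")
      case True
      then have d: "infdist x (- U) > 0" using U ne by (intro infdist_pos_not_in_closed) auto
      obtain N :: nat where N: "1 / infdist x (- U) < N" using reals_Archimedean2 by blast
      have "f n x = 1" if "n \<ge> N" for n
      proof -
        have "1 / infdist x (- U) < n" using N that by simp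
        then have "1 < n * infdist x (- U)" using d by (simp add: field_simps)
        then show ?thesis by (simp add: f_def)
      qed
      then have "\<forall>\<^sub>F n in sequentially. complex_of_real (f n x) = indicator U x"
        using True by (auto simp: eventually_sequentially)
      then show ?thesis by (rule tendsto_eventually)
    next
      case False
      then show ?thesis by (simp add: f_def)
    qed
    show "cmod (of_real (f n x)) \<le> 1" for n x using f01[of n x] by simp
  qed auto
qed

text \<open>The closed span is linear and closed under dominated limits, so complements and
  countable disjoint unions are harmless; intersections would call for products. Hence Dynkin's
  argument, with the open sets as the generator stable under intersections.\<close>

lemma spectral_approx_indicator:
  assumes bc: "bounded_complexity X T M" and A: "A \<in> sets borel"
  shows "spectral_approx M T (indicator A)"
proof -
  have "Int_stable {S :: 'a set. open S}" by (auto simp: Int_stable_def)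
  moreover have "{S :: 'a set. open S} \<subseteq> Pow UNIV" by auto
  moreover have "A \<in> sigma_sets UNIV {S. open S}" using A by (simp add: sets_borel)
  ultimately show ?thesis
  proof (induction rule: sigma_sets_induct_disjoint)
    case (basic A)
    then show ?case using spectral_approx_indicator_open[OF bc] by simp
  next
    case empty
    show ?case by (rule spectral_approx_null) auto
  next
    case (compl A)
    have "spectral_approx M T (\<lambda>x. indicator UNIV x + - 1 * indicator A x)"
      by (intro spectral_approx_add spectral_approx_cmult compl spectral_approx_indicator_open[OF bc]) auto
    then show ?case by (rule spectral_approx_cong) (auto simp: indicator_def)
  next
    case (union A)
    have A_borel: "A i \<in> sets borel" for i using union(2) by (auto simp: sets_borel)
    show ?case
    proof (rule spectral_approx_dominated[where u = "\<lambda>n. indicator (\<Union>i<n. A i)" and w = "\<lambda>_. 1"])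
      show "spectral_approx M T (indicator (\<Union>i<n. A i))" for n
      proof -
        have "spectral_approx M T (\<lambda>x. \<Sum>i<n. indicator (A i) x)"
          by (intro spectral_approx_sum union)
        then show ?thesis
        proof (rule spectral_approx_cong)
          show "indicator (\<Union>i<n. A i) x = (\<Sum>i<n. indicator (A i) x :: complex)" for x
            using union(1) by (intro indicator_UN_disjoint) (auto simp: disjoint_family_on_def)
        qed
      qed
      show "(indicator (\<Union>i. A i) :: 'a \<Rightarrow> complex) \<in> borel_measurable M"
        using A_borel by (intro indicator_measurable) auto
      show "(\<lambda>n. indicator (\<Union>i<n. A i) x) \<longlonglongrightarrow> (indicator (\<Union>i. A i) x :: complex)" for x
        by (rule LIMSEQ_indicator_UN)
    qed (auto simp: indicator_def)
  qed
qed

lemma spectral_approx_square_integrable: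
  assumes bc: "bounded_complexity X T M" and f: "square_integrable M f"
  shows "spectral_approx M T f"
proof -
  have f_meas: "f \<in> borel_measurable M" and f_int: "integrable M (\<lambda>x. (cmod (f x))\<^sup>2)"
    using f by (auto simp: square_integrable_def)
  obtain s where s: "\<And>i. simple_function M (s i)" "\<And>x. x \<in> space M \<Longrightarrow> (\<lambda>i. s i x) \<longlonglongrightarrow> f x"
    "\<And>i x. x \<in> space M \<Longrightarrow> dist (s i x) 0 \<le> 2 * dist (f x) 0"
    using borel_measurable_implies_sequence_metric[OF f_meas, of 0] by blast
  show ?thesis
  proof (rule spectral_approx_dominated[where u = s and w = "\<lambda>x. 2 * cmod (f x)"])
    show "spectral_approx M T (s i)" for i
    proof (rule spectral_approx_cong)
      show "s i x = (\<Sum>y\<in>s i ` space M. y * indicator (s i -` {y} \<inter> space M) x)" if "x \<in> space M" for x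
        by (subst simple_function_indicator_representation_banach[OF s(1) that])
          (intro sum.cong, auto simp: indicator_def)
      show "spectral_approx M T (\<lambda>x. \<Sum>y\<in>s i ` space M. y * indicator (s i -` {y} \<inter> space M) x)"
      proof (intro spectral_approx_sum spectral_approx_cmult)
        fix y
        have "s i -` {y} \<inter> space M \<in> sets M" using s(1) by (rule simple_functionD(2))
        \<comment> \<open>Measurable sets of \<open>M\<close> are traces of Borel sets on
          \<open>X\<close>, and \<open>spectral_approx_cong\<close> looks only at points of
          \<open>X\<close>.\<close>
        then obtain A where A: "A \<in> sets borel" "s i -` {y} \<inter> space M = X \<inter> A"
          by (auto simp: sets_M sets_restrict_space)
        show "spectral_approx M T (indicator (s i -` {y} \<inter> space M))"
          unfolding A(2) by (rule spectral_approx_cong[OF spectral_approx_indicator[OF bc A(1)]])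
            (auto simp: space_M indicator_def)
      qed
    qed
    show "integrable M (\<lambda>x. (2 * cmod (f x))\<^sup>2)" using f_int by (simp add: power_mult_distrib)
  qed (use s f_meas in auto)
qed

end

theorem mainTheorem11:
  fixes X :: "'a::metric_space set" and T :: "'a \<Rightarrow> 'a" and M :: "'a measure"
  assumes "compact X"
    and "homeomorphism X X T T'"
    and "sets M = sets (restrict_space borel X)"
    and "prob_space M"
    and "T \<in> measurable M M" and "distr M M T = M"
    and "bounded_complexity X T M"
  shows "discrete_spectrum M T"
proof -
  interpret prob_space M by fact
  interpret metric_system M T X
    by unfold_locales (use assms in \<open>auto simp: homeomorphism_def\<close>)
  show ?thesis
    using spectral_approx_square_integrable[OF assms(7)]
    unfolding discrete_spectrum_def spectral_approx_def by blast
qed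

end
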